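(* Let $X=(X_k)_{k\ge 0}$ be the Markov chain on $\mathbb Z^+=\{0,1,2,\dots\}$ with $X_0=0$ and transition probabilities $P(X_{k+1}=n+2\mid X_k=n)=p_n$ and $P(X_{k+1}=n-1\mid X_k=n)=q_n=1-p_n$ for $n\ge 1$, and $P(X_{k+1}=2\mid X_k=0)=1$. Suppose that $p_n=\frac13+r_n$ for $n\ge1$, with $0\le r_n<\frac23$, $r_n\downarrow 0$ and $r_n-r_{n+1}=O(r_n^2)$ as $n\to\infty$. Let $a_n=q_n/p_n$, let $(\xi_n)_{n\ge1}$ be the (unique) positive solution of $\xi_n=\frac{1}{a_n}\left(1+\frac{1}{\xi_{n+1}}\right)$, $n\ge 1$, let $U_i=1/\xi_i$, and let $D(m)=\lim_{n\to\infty}\sum_{j=m+1}^{n}\prod_{i=m+1}^{j-1}U_i$ for $m\ge1$. (1) If $\sum_{n=2}^\infty\frac{1}{D(n)\log n}<\infty$, then almost surely $X$ has at most finitely many skipped points. (2) If there exists some $\delta>0$ such that $D(n)\le\delta n\log n$ for all $n$ large enough, and $\sum_{n=2}^\infty\frac{1}{D(n)\log n}=\infty$, then with a positive probability $p$, $p\ge\frac{11}{27}$, $X$ has infinitely many skipped points.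
   Context: A site $k$ is a skipped point of $X$ if $\#\{n\ge0:X_n=k\}=0$, i.e. $k$ is never visited by $X$. An empty product equals $1$. The limit $D(m)$ is taken in $(0,\infty]$, with $1/\infty=0$. Since $\lim_n r_n=0$, we have $\sum_n 1/a_n=\infty$, which is known to imply that the recursion $\xi_n=\frac{1}{a_n}(1+\frac1{\xi_{n+1}})$, $n\ge1$, has exactly one solution with all $\xi_n>0$. The notation $r_n\downarrow0$ means that $r_n$ is decreasing in $n$ with limit $0$. Throughout, $O(g(i))$ denotes a quantity with $\lim_{i\to\infty}O(g(i))/g(i)=C$ for some constant $C$. *)

theory Defs
  imports "HOL-Probability.Probability"
begin

text \<open>Time-homogeneous discrete-time Markov chain with initial state \<open>x0\<close> and transition
  matrix \<open>P\<close>; the transition law is imposed only on histories of positive probability.\<close>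

definition markov_chain ::
  "'w measure \<Rightarrow> (nat \<Rightarrow> 'w \<Rightarrow> nat) \<Rightarrow> nat \<Rightarrow> (nat \<Rightarrow> nat \<Rightarrow> real) \<Rightarrow> bool"
  where "markov_chain M X x0 P \<longleftrightarrow>
    prob_space M \<and>
    (\<forall>k. X k \<in> M \<rightarrow>\<^sub>M count_space UNIV) \<and>
    (AE \<omega> in M. X 0 \<omega> = x0) \<and>
    (\<forall>k x y. \<P>(\<omega> in M. \<forall>l\<le>k. X l \<omega> = x l) \<noteq> 0 \<longrightarrow>
       \<P>(\<omega> in M. X (Suc k) \<omega> = y \<bar> \<forall>l\<le>k. X l \<omega> = x l) = P (x k) y)"

definition walk_transition :: "(nat \<Rightarrow> real) \<Rightarrow> (nat \<Rightarrow> real) \<Rightarrow> nat \<Rightarrow> nat \<Rightarrow> real"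
  where "walk_transition p q n y =
    (if n = 0 then (if y = 2 then 1 else 0)
     else if y = n + 2 then p n
     else if y = n - 1 then q n
     else 0)"

definition skipped_points :: "(nat \<Rightarrow> 'w \<Rightarrow> nat) \<Rightarrow> 'w \<Rightarrow> nat set"
  where "skipped_points X \<omega> = {k. {n. X n \<omega> = k} = {}}"

text \<open>The convention for \<open>f i = O(g i)\<close> used here requires the quotient to have a finite
  limit, so it is more restrictive than the usual Landau symbol.  Where \<open>g\<close> vanishes the
  quotient is \<open>0\<close>; for \<open>f i = r i - r (i + 1)\<close> and \<open>g i = (r i)^2\<close> with \<open>r\<close> nonnegative and
  decreasing, \<open>f\<close> vanishes there too.\<close>

definition O_lim :: "(nat \<Rightarrow> real) \<Rightarrow> (nat \<Rightarrow> real) \<Rightarrow> bool"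
  where "O_lim f g \<longleftrightarrow> (\<exists>C::real. (\<lambda>i. f i / g i) \<longlonglongrightarrow> C)"

definition positive_solution :: "(nat \<Rightarrow> real) \<Rightarrow> (nat \<Rightarrow> real) \<Rightarrow> bool"
  where "positive_solution a \<xi> \<longleftrightarrow>
    (\<forall>n\<ge>1. \<xi> n > 0 \<and> \<xi> n = 1 / a n * (1 + 1 / \<xi> (n + 1)))"

text \<open>The partial sums are nondecreasing for positive \<open>U\<close>, so the limit exists in
  \<open>ennreal\<close>, with \<open>\<infinity>\<close> as a possible value.\<close>

definition D_lim :: "(nat \<Rightarrow> real) \<Rightarrow> nat \<Rightarrow> ennreal"
  where "D_lim U m = lim (\<lambda>n. \<Sum>j=m+1..n. ennreal (\<Prod>i=m+1..j-1. U i))"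

end

theory Submission
  imports Defs "HOL-Analysis.Harmonic_Numbers"
begin

text \<open>
The scale function \<open>sc x = (\<Sum>j\<le>x. U 1 \<cdots> U (j - 1))\<close> is harmonic for the walk on the positive sites, and
in the transient case \<open>1 / D n\<close> is the probability of never visiting \<open>n\<close> from \<open>n + 1\<close>. Together with
a second, exponentially growing alternating harmonic function it gives the probability that a
finite set of sites is skipped. These probabilities have a renewal structure: \<open>n\<close> is skipped with
probability comparable to \<open>1 / D n\<close>, and, given this, \<open>n + j\<close> is skipped with probability comparable to
\<open>D n / (S D (n + j)) = 1 / D (n + j) + \<pi> / S\<close>, where \<open>D n = S + \<pi> D (n + j)\<close> splits the series for \<open>D n\<close>
after \<open>j\<close> terms.

For (1), regularity of \<open>r\<close> gives \<open>D (n + j) = O(D n + j)\<close> for \<open>j \<le> n\<close>, so the conditional probability is at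
least of order \<open>1 / j\<close> and a dyadic block with a skipped point contains about \<open>log n\<close> of them in
expectation. Decomposing at the first skipped point of the block and summing, Borel-Cantelli applies.

For (2), let \<open>Z\<close> be the sum of \<open>1 / log n\<close> over the skipped \<open>n\<close>. The term \<open>1 / D (n + j)\<close> is cancelled by
the product of the means, and the sum of \<open>\<pi> / S\<close> over \<open>j\<close> is at most \<open>2 log D n = O(log n)\<close>; so the
variance of a partial sum of \<open>Z\<close> is of the order of its diverging mean, and by Chebyshev \<open>Z = \<infinity>\<close> almost
surely. The probability in (2) is therefore 1.
\<close>

section \<open>Harmonic functions of the walk\<close>

text \<open>The analytic data alone, without the chain. \<open>U_rec\<close> is the recursion for
  \<open>\<xi>\<close> rewritten for \<open>U = 1 / \<xi>\<close>; in this form it makes products of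
  \<open>U\<close> the increments of a harmonic function.\<close>

locale drifted_walk =
  fixes p q r a U :: "nat \<Rightarrow> real"
  assumes q_eq: "\<And>n. n \<ge> 1 \<Longrightarrow> q n = 1 - p n"
    and p_eq: "\<And>n. n \<ge> 1 \<Longrightarrow> p n = 1/3 + r n"
    and r_bounds: "\<And>n. n \<ge> 1 \<Longrightarrow> 0 \<le> r n \<and> r n < 2/3"
    and r_Suc_le: "\<And>n. n \<ge> 1 \<Longrightarrow> r (n + 1) \<le> r n"
    and a_eq: "\<And>n. n \<ge> 1 \<Longrightarrow> a n = q n / p n"
    and U_pos: "\<And>n. n \<ge> 1 \<Longrightarrow> 0 < U n"
    and U_rec: "\<And>n. n \<ge> 1 \<Longrightarrow> U n * (1 + U (n + 1)) = a n"
begin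

section \<open>Bounds on \<open>a\<close> and \<open>U\<close> in terms of the drift
  \<open>r\<close>\<close>

lemma p_pos: "n \<ge> 1 \<Longrightarrow> 0 < p n"
  using p_eq r_bounds by fastforce

lemma q_pos: "n \<ge> 1 \<Longrightarrow> 0 < q n"
  using q_eq p_eq r_bounds by fastforce

lemma a_mult_p: "n \<ge> 1 \<Longrightarrow> a n * p n = q n"
  using a_eq p_pos by fastforce

lemma r_antimono:
  assumes "1 \<le> m" "m \<le> n"
  shows "r n \<le> r m"
  using assms(2)
proof (induction n rule: dec_induct)
  case (step n)
  then show ?case using r_Suc_le[of n] assms(1) by simp
qed simp

text \<open>Without drift, \<open>r n = 0\<close>, one has \<open>a n = 2\<close>, and
  \<open>U = 1\<close> solves the recursion; deviations from this are measured by the deficit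
  \<open>2 - a n\<close>.\<close>

lemma two_minus_a: "n \<ge> 1 \<Longrightarrow> 2 - a n = 9 * r n / (1 + 3 * r n)"
  using a_eq[of n] p_eq[of n] q_eq[of n] r_bounds[of n] by (simp add: field_simps)

lemma a_mono:
  assumes "1 \<le> m" "m \<le> n"
  shows "a m \<le> a n"
proof -
  have "9 * r n / (1 + 3 * r n) \<le> 9 * r m / (1 + 3 * r m)"
    using r_antimono[OF assms] r_bounds[of m] r_bounds[of n] assms
    by (simp add: field_simps)
  then show ?thesis
    using two_minus_a[of m] two_minus_a[of n] assms by linarith
qed

lemma a_pos: "n \<ge> 1 \<Longrightarrow> 0 < a n"
  using a_eq p_pos q_pos by simp

lemma a_le_2: "n \<ge> 1 \<Longrightarrow> a n \<le> 2"
  using two_minus_a[of n] r_bounds[of n] by (smt (verit) divide_nonneg_nonneg)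

lemma U_le_2: "n \<ge> 1 \<Longrightarrow> U n \<le> 2"
proof -
  assume n: "n \<ge> 1"
  have "U n * 1 \<le> U n * (1 + U (n + 1))"
    using U_pos[of n] U_pos[of "n+1"] n by (intro mult_left_mono) auto
  then show ?thesis using U_rec[OF n] a_le_2[OF n] by linarith
qed

text \<open>A value \<open>1 + y\<close> forces the next value \<open>u\<close> below
  \<open>(1 - y) / (1 + y)\<close>, because \<open>a n\<close> is at most 2. As \<open>a\<close> is
  nondecreasing, \<open>a (n + 1)\<close> is at least \<open>(1 + y) * (1 + u)\<close>, and dividing
  by the small \<open>u\<close> pushes the value after that further above 1.\<close>

lemma U_excess:
  assumes n: "n \<ge> 1" and y: "0 < y" and U: "U n \<ge> 1 + y"
  shows "U (n + 2) \<ge> 1 + 3 * y"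
proof -
  define u where "u = U (n + 1)"
  have u: "0 < u" using U_pos u_def by simp
  have "(1 + y) * (1 + u) \<le> a n"
    using U_rec[OF n] mult_right_mono[OF U, of "1 + u"] u by (simp add: u_def)
  then have uy: "(1 + y) * (1 + u) \<le> a n" .
  have rec: "u * (1 + U (n + 2)) = a (n + 1)"
    using U_rec[of "n+1"] by (simp add: u_def)
  have an: "a n \<le> a (n + 1)" "a n \<le> 2"
    using a_mono[of n "n+1"] a_le_2[OF n] n by auto
  have "u \<le> (1 - y) / (1 + y)"
    using uy an y by (simp add: field_simps)
  then have y1: "u * (1 + y) \<le> 1 - y" using y by (simp add: field_simps)
  have "u * (2 + 3 * y) \<le> (1 + y) * (1 + u)"
  proof -
    have "u * (2 + 3 * y) - (1 + y) * (1 + u) = u * (1 + 2 * y) - (1 + y)"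
      by (simp add: algebra_simps)
    also have "\<dots> \<le> 0"
    proof -
      have "0 < u * (1 + y)" using u y by simp
      have "0 < u * y" using u y by simp
      then have "u \<le> 1" using y1 y by (simp add: algebra_simps)
      then have "u * y \<le> y" using y by simp
      moreover have "u * (1 + 2 * y) = u * (1 + y) + u * y" by (simp add: algebra_simps)
      ultimately show ?thesis using y1 y by linarith
    qed
    finally show ?thesis by simp
  qed
  then have "u * (2 + 3 * y) \<le> u * (1 + U (n + 2))"
    using uy an rec by linarith
  then show ?thesis using u by simp
qed

text \<open>If \<open>U n = 1 + y\<close> with \<open>y > 0\<close>, the excess over 1 is at least tripled every two steps, against
  the bound \<open>U \<le> 2\<close>.\<close>

lemma U_le_1:
  assumes n: "n \<ge> 1"
  shows "U n \<le> 1"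
proof (rule ccontr)
  assume "\<not> U n \<le> 1"
  define y where "y = U n - 1"
  have y: "0 < y" using \<open>\<not> U n \<le> 1\<close> y_def by simp
  have step: "U (n + 2 * k) \<ge> 1 + 3 ^ k * y" for k
  proof (induction k)
    case 0
    then show ?case by (simp add: y_def)
  next
    case (Suc k)
    then show ?case using U_excess[of "n + 2*k" "3^k * y"] n y by simp
  qed
  obtain k where "1 / y < 3 ^ k"
    using real_arch_pow[of 3 "1/y"] by auto
  then have "1 < 3 ^ k * y" using y by (simp add: field_simps)
  with step[of k] U_le_2[of "n + 2*k"] n show False by simp
qed

lemma one_minus_U_upper: "n \<ge> 1 \<Longrightarrow> 1 - U n \<le> (2 - a n) / 2"
proof -
  assume n: "n \<ge> 1"
  have "U n * (1 + U (n + 1)) \<le> U n * 2"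
    using U_pos[of n] U_le_1[of "n+1"] n by (intro mult_left_mono) auto
  then show ?thesis using U_rec[OF n] by simp
qed

text \<open>Writing both factors in \<open>U_rec\<close> through their deficits and dropping the
  product of the deficits bounds \<open>2 - a n\<close> by twice the deficit of \<open>U n\<close>
  plus that of \<open>U (n + 1)\<close>; the latter is at most \<open>(2 - a n) / 2\<close> by the
  upper bound and monotonicity of \<open>a\<close>.\<close>

lemma one_minus_U_lower: "n \<ge> 1 \<Longrightarrow> (2 - a n) / 4 \<le> 1 - U n"
proof -
  assume n: "n \<ge> 1"
  have "2 - a n \<le> 2 * (1 - U n) + (1 - U (n + 1))"
    using U_rec[OF n] mult_nonneg_nonneg[of "1 - U n" "1 - U (n+1)"] U_le_1[of n] U_le_1[of "n+1"] n
    by (simp add: algebra_simps)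
  moreover have "1 - U (n + 1) \<le> (2 - a n) / 2"
    using one_minus_U_upper[of "n+1"] a_mono[of n "n+1"] n by simp
  ultimately show ?thesis by simp
qed

section \<open>The scale function \<open>sc\<close> and its increments \<open>d\<close>\<close>

definition d :: "nat \<Rightarrow> real" where "d j = (\<Prod>i\<in>{1..<j}. U i)"

lemma d_Suc: "n \<ge> 1 \<Longrightarrow> d (Suc n) = U n * d n"
  by (simp add: d_def prod.atLeastLessThan_Suc mult.commute)

lemma d_pos: "0 < d n"
  unfolding d_def by (intro prod_pos) (auto intro: U_pos)

lemma d_Suc_le: "d (Suc n) \<le> d n"
proof (cases "n = 0")
  case False
  then show ?thesis using d_Suc[of n] U_le_1[of n] d_pos[of n] by (simp add: mult_left_le_one_le)
qed (simp add: d_def)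

lemma d_antimono: "m \<le> n \<Longrightarrow> d n \<le> d m"
  by (rule lift_Suc_antimono_le[of d]) (auto intro: d_Suc_le)

text \<open>An upward jump crosses two increments of \<open>sc\<close>, a downward jump one, so this
  linear form of \<open>U_rec\<close> is harmonicity of \<open>sc\<close> at
  \<open>n\<close>.\<close>

lemma d_rec: "n \<ge> 1 \<Longrightarrow> d (n + 1) + d (n + 2) = a n * d n"
  using d_Suc[of n] d_Suc[of "Suc n"] U_rec[of n, symmetric] by (simp add: algebra_simps)

definition sc :: "nat \<Rightarrow> real" where "sc x = (\<Sum>j\<in>{1..x}. d j)"

lemma sc_0: "sc 0 = 0" by (simp add: sc_def)

lemma sc_Suc: "sc (Suc x) = sc x + d (Suc x)" by (simp add: sc_def)

lemma sc_strict_mono: "strict_mono sc"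
  by (intro strict_monoI_Suc) (simp add: sc_Suc d_pos)

lemma sc_less: "m < n \<Longrightarrow> sc m < sc n"
  using sc_strict_mono by (simp add: strict_mono_def)

lemma sc_mono: "m \<le> n \<Longrightarrow> sc m \<le> sc n"
  using sc_strict_mono by (simp add: strict_mono_less_eq)

text \<open>At 0 the jump to 2 is forced, which imposes the boundary condition
  \<open>f 2 = f 0\<close>; \<open>sc\<close> violates it, \<open>V\<close> below satisfies
  it.\<close>

definition harmonic_at :: "(nat \<Rightarrow> real) \<Rightarrow> nat \<Rightarrow> bool" where
  "harmonic_at f x \<longleftrightarrow> (if x = 0 then f 2 = f 0 else p x * f (x + 2) + q x * f (x - 1) = f x)"

text \<open>Harmonicity at \<open>x\<close> involves only \<open>x - 1\<close>, \<open>x\<close> and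
  \<open>x + 2\<close>; this locality is what permits gluing.\<close>

lemma harmonic_at_cong:
  assumes "f (x - 1) = g (x - 1)" "f x = g x" "f (x + 2) = g (x + 2)"
  shows "harmonic_at f x \<longleftrightarrow> harmonic_at g x"
  using assms unfolding harmonic_at_def by (metis add_0)

lemma harmonic_at_affine:
  assumes "harmonic_at f x" "harmonic_at g x"
  shows "harmonic_at (\<lambda>y. b * f y + c * g y + k) x"
proof (cases "x = 0")
  case False
  then have pq: "q x = 1 - p x" and f: "p x * f (x + 2) + q x * f (x - 1) = f x"
    and g: "p x * g (x + 2) + q x * g (x - 1) = g x"
    using assms q_eq[of x] by (auto simp: harmonic_at_def)
  have "p x * (b * f (x + 2) + c * g (x + 2) + k) + q x * (b * f (x - 1) + c * g (x - 1) + k)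
     = b * (p x * f (x + 2) + q x * f (x - 1)) + c * (p x * g (x + 2) + q x * g (x - 1)) + k"
    unfolding pq by (simp add: algebra_simps)
  then show ?thesis using False f g by (simp add: harmonic_at_def)
qed (use assms in \<open>simp add: harmonic_at_def\<close>)

lemma harmonic_at_diff:
  assumes x: "x \<ge> 1" and step: "f (x + 2) - f x = a x * (f x - f (x - 1))"
  shows "harmonic_at f x"
proof -
  have "p x * f (x + 2) + q x * f (x - 1) - f x
      = p x * (f (x + 2) - f x) - q x * (f x - f (x - 1))"
    unfolding q_eq[OF x] by (simp add: algebra_simps)
  also have "\<dots> = 0"
    unfolding step using a_mult_p[OF x, symmetric] by simp
  finally show ?thesis using x by (simp add: harmonic_at_def)
qed

lemma harmonic_at_sc: "x \<ge> 1 \<Longrightarrow> harmonic_at sc x"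
  using d_rec[of x] sc_Suc[of "x - 1"] by (intro harmonic_at_diff) (auto simp: sc_Suc algebra_simps)

section \<open>A second, alternating harmonic function with exponentially growing increments\<close>

fun w :: "nat \<Rightarrow> real" where
  "w 0 = 0"
| "w (Suc 0) = 1"
| "w (Suc (Suc n)) = w (Suc n) + a n * w n"

lemma w_nonneg: "0 \<le> w n"
proof (induction n rule: w.induct)
  case (3 n)
  then show ?case using a_pos[of n] by (cases "n = 0") auto
qed auto

lemma w_Suc_ge: "w n \<le> w (Suc n)"
proof (cases n)
  case (Suc k)
  then show ?thesis using a_pos[of k] w_nonneg[of k] by (cases "k = 0") auto
qed auto

lemma w_mono: "m \<le> n \<Longrightarrow> w m \<le> w n"
  by (rule lift_Suc_mono_le[of w]) (auto intro: w_Suc_ge)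

lemma w_pos: "n \<ge> 1 \<Longrightarrow> 0 < w n"
  using w_mono[of 1 n] by simp

lemma w_Suc_le: "n \<ge> 1 \<Longrightarrow> w (Suc n) \<le> 3 * w n"
proof -
  assume "n \<ge> 1"
  then obtain k where n: "n = Suc k" by (cases n) auto
  have "a k * w k \<le> 2 * w k"
    using a_le_2[of k] w_nonneg[of k] by (cases "k = 0") (auto intro: mult_right_mono)
  then show ?thesis using w_Suc_ge[of k] n by simp
qed

text \<open>The term \<open>a n * w n\<close> added in the recursion is at least the share
  \<open>a 1 / 3\<close> of \<open>w (Suc n)\<close>, since \<open>w\<close> at most triples in a
  step and \<open>a\<close> is nondecreasing. The rate is thus uniform in \<open>n\<close>.\<close>

lemma w_growth:
  assumes n: "n \<ge> 1"
  shows "(1 + a 1 / 3) * w (Suc n) \<le> w (Suc (Suc n))"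
proof -
  have "a 1 / 3 * w (Suc n) \<le> a 1 / 3 * (3 * w n)"
    using w_Suc_le[OF n] a_pos[of 1] by (intro mult_left_mono) auto
  also have "\<dots> \<le> a n * w n"
    using a_mono[of 1 n] n w_nonneg[of n] by (simp add: mult_right_mono)
  finally show ?thesis by (simp add: algebra_simps)
qed

lemma w_ratio:
  assumes n: "n \<ge> 1"
  shows "w (Suc n) / w (Suc (n + j)) \<le> (1 / (1 + a 1 / 3)) ^ j"
proof -
  define c where "c = 1 + a 1 / 3"
  have c: "c > 0" using a_pos[of 1] by (simp add: c_def)
  have "c ^ j * w (Suc n) \<le> w (Suc (n + j))"
  proof (induction j)
    case (Suc j)
    have "c ^ Suc j * w (Suc n) = c * (c ^ j * w (Suc n))" by simp
    also have "\<dots> \<le> c * w (Suc (n + j))"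
      using Suc c by (intro mult_left_mono) auto
    also have "\<dots> \<le> w (Suc (n + Suc j))"
      using w_growth[of "n + j"] n by (simp add: c_def)
    finally show ?case .
  qed simp
  then have "w (Suc n) \<le> w (Suc (n + j)) / c ^ j"
    using c by (simp add: pos_le_divide_eq mult.commute)
  then show ?thesis
    using w_pos[of "Suc (n + j)"] unfolding c_def[symmetric] power_one_over
    by (simp add: pos_divide_le_eq)
qed

text \<open>The sign turns the increment equation of harmonicity,
  \<open>v (x + 1) + v (x + 2) = a x * v x\<close>, into the recursion of \<open>w\<close>. The
  start \<open>w 0 = 0\<close> gives \<open>w 2 = w 1\<close>, hence \<open>V 2 = V 0\<close>, and
  keeps the unspecified \<open>a 0\<close> out.\<close>

definition V :: "nat \<Rightarrow> real" where "V x = (\<Sum>y\<le>x. (- 1) ^ y * w y)"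

lemma V_Suc: "V (Suc x) = V x + (- 1) ^ Suc x * w (Suc x)" by (simp add: V_def)

lemma harmonic_at_V: "harmonic_at V x"
proof (cases "x = 0")
  case False
  then have "V x = V (x - 1) + (- 1) ^ x * w x" using V_Suc[of "x - 1"] by simp
  then show ?thesis using False
    by (intro harmonic_at_diff) (auto simp: V_Suc algebra_simps)
qed (simp add: harmonic_at_def V_def numeral_2_eq_2)

text \<open>An alternating sum with nondecreasing absolute terms has the sign of its last term and
  is bounded by it.\<close>

lemma alternating_bounds:
  assumes "x \<le> m"
  shows "0 \<le> (- 1) ^ m * (V m - V x) \<and> (- 1) ^ m * (V m - V x) \<le> w m"
  using assms
proof (induction m rule: dec_induct)
  case base
  then show ?case using w_nonneg by simp
next
  case (step m)
  have "(- 1) ^ Suc m * (V (Suc m) - V x) = w (Suc m) - (- 1) ^ m * (V m - V x)"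
    by (simp add: V_Suc algebra_simps flip: power_add mult_2)
  then show ?case using step w_Suc_ge[of m] by linarith
qed

text \<open>\<open>e m x\<close> is the probability that the walk started from \<open>x < m\<close> first enters
  \<open>{m..}\<close> at \<open>m + 1\<close>.\<close>

definition e :: "nat \<Rightarrow> nat \<Rightarrow> real" where
  "e m x = (- 1) ^ m * (V m - V x) / w (Suc m)"

lemma e_self: "e m m = 0" by (simp add: e_def)

lemma e_Suc_self: "e m (Suc m) = 1"
  using w_pos[of "Suc m"] by (simp add: e_def V_Suc algebra_simps flip: power_add mult_2)

lemma harmonic_at_e: "harmonic_at (e m) x"
proof -
  have "e m = (\<lambda>y. - ((-1)^m / w (Suc m)) * V y + 0 * V y + (-1)^m * V m / w (Suc m))"
    by (simp add: e_def fun_eq_iff right_diff_distrib diff_divide_distrib)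
  then show ?thesis by (simp only: harmonic_at_affine[OF harmonic_at_V harmonic_at_V])
qed

lemma e_nonneg: "x \<le> m \<Longrightarrow> 0 \<le> e m x"
  using alternating_bounds[of x m] w_pos[of "Suc m"] by (simp add: e_def)

lemma e_le_1: "x \<le> m \<Longrightarrow> e m x \<le> 1"
  using alternating_bounds[of x m] w_pos[of "Suc m"] w_Suc_ge[of m] by (simp add: e_def)

text \<open>By the alternating bounds the numerator is at least
  \<open>w m - w (m - 1) = a (m - 2) * w (m - 2)\<close>. Three triplings compare this with
  \<open>w (m + 1)\<close>, hence the 27; \<open>m \<ge> 3\<close> keeps the index of
  \<open>a\<close> positive.\<close>

lemma e_ge:
  assumes "x < m" "m \<ge> 3"
  shows "a 1 / 27 \<le> e m x"
proof -
  obtain k where m: "m = Suc (Suc k)" and k: "k \<ge> 1"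
    using assms(2) by (intro that[of "m - 2"]) auto
  have "(- 1) ^ m * (V m - V x) = w m - (- 1) ^ (Suc k) * (V (Suc k) - V x)"
    unfolding m V_Suc[of "Suc k"] by (simp add: algebra_simps flip: power_add mult_2)
  also have "\<dots> \<ge> w m - w (Suc k)"
    using alternating_bounds[of x "Suc k"] assms m by simp
  finally have "a k * w k \<le> (- 1) ^ m * (V m - V x)"
    by (simp add: m)
  moreover have "a 1 * w k \<le> a k * w k"
    using a_mono[of 1 k] k w_nonneg[of k] by (intro mult_right_mono) auto
  moreover have "w (Suc m) \<le> 27 * w k"
    using w_Suc_le[of m] w_Suc_le[of "Suc k"] w_Suc_le[of k] k m by simp
  ultimately have *: "a 1 / 27 * w (Suc m) \<le> (- 1) ^ m * (V m - V x)"
    using mult_left_mono[of "w (Suc m)" "27 * w k" "a 1 / 27"] a_pos[of 1] by linarith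
  then show ?thesis
    using w_pos[of "Suc m"] unfolding e_def by (subst pos_le_divide_eq) auto
qed

lemma e_Suc_diff: "e m (Suc n) - e m n = (- 1) ^ (m + n) * w (Suc n) / w (Suc m)"
  by (simp add: e_def V_Suc diff_divide_distrib[symmetric] power_add algebra_simps)

text \<open>Loss of memory: by \<open>w_ratio\<close> the starting point affects \<open>e m\<close>
  only by an amount that decays geometrically in its distance to \<open>m\<close>.\<close>

lemma e_0_diff: "\<bar>e m n - e m 0\<bar> \<le> w n / w (Suc m)"
proof -
  have "e m n - e m 0 = - ((- 1) ^ m * (V n - V 0)) / w (Suc m)"
    by (simp add: e_def diff_divide_distrib[symmetric] algebra_simps)
  moreover have "\<bar>(- 1) ^ m * (V n - V 0)\<bar> = \<bar>(- 1) ^ n * (V n - V 0)\<bar>"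
    by (simp add: abs_mult)
  moreover have "\<dots> \<le> w n" using alternating_bounds[of 0 n] by simp
  ultimately show ?thesis
    using w_pos[of "Suc m"] by (simp add: divide_right_mono)
qed

section \<open>Jumping over a site while avoiding a lower one\<close>

definition S :: "nat \<Rightarrow> nat \<Rightarrow> real" where "S n m = (sc m - sc n) / d (Suc n)"

lemma S_Suc_self: "S n (Suc n) = 1"
  using d_pos[of "Suc n"] by (simp add: S_def sc_Suc)

text \<open>Together with \<open>S n n = 0\<close> this identifies \<open>S n m\<close> as the sum
  of the first \<open>m - n\<close> terms of the series for \<open>D n\<close>.\<close>

lemma S_Suc: "S n (Suc m) = S n m + d (Suc m) / d (Suc n)"
  by (simp add: S_def sc_Suc add_divide_distrib diff_divide_distrib)

lemma S_mono: "m \<le> m' \<Longrightarrow> S n m \<le> S n m'"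
  using sc_mono[of m m'] d_pos[of "Suc n"] by (simp add: S_def divide_right_mono)

lemma S_ge_1: "n < m \<Longrightarrow> 1 \<le> S n m"
  using S_mono[of "Suc n" m n] S_Suc_self by simp

lemma S_le: "S n (n + j) \<le> real j"
proof (induction j)
  case 0
  then show ?case by (simp add: S_def)
next
  case (Suc j)
  have "d (Suc (n + j)) / d (Suc n) \<le> 1"
    using d_antimono[of "Suc n" "Suc (n + j)"] d_pos[of "Suc n"] by simp
  then show ?case using Suc S_Suc[of n "n + j"] by simp
qed

text \<open>\<open>G n m\<close> below is the probability that the walk from \<open>n + 1\<close> jumps over \<open>m\<close> without
  visiting \<open>n\<close> or \<open>m\<close>.\<close>

definition bvp :: "nat \<Rightarrow> nat \<Rightarrow> nat \<Rightarrow> real" where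
  "bvp n m x = (e m x - e m n * ((sc m - sc x) / (sc m - sc n)))
     / (1 + e m n * (d (Suc m) / (sc m - sc n)))"

text \<open>In \<open>bvp\<close> the \<open>sc\<close> term vanishes at \<open>m\<close> and equals
  \<open>e m n\<close> at \<open>n\<close>, so the numerator is 0 at both sites; the denominator is
  the value of the numerator at \<open>m + 1\<close>.\<close>

lemma bvp_denominator: "n < m \<Longrightarrow> 1 \<le> 1 + e m n * (d (Suc m) / (sc m - sc n))"
  using e_nonneg[of n m] d_pos[of "Suc m"] sc_less[of n m] by simp

lemma bvp_left: "n < m \<Longrightarrow> bvp n m n = 0"
  using sc_less[of n m] by (simp add: bvp_def)

lemma bvp_right: "bvp n m m = 0"
  by (simp add: bvp_def e_self)

lemma bvp_Suc_right: "n < m \<Longrightarrow> bvp n m (Suc m) = 1"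
  using bvp_denominator[of n m] by (simp add: bvp_def e_Suc_self sc_Suc)

lemma harmonic_at_bvp:
  assumes "n < m" "x \<ge> 1"
  shows "harmonic_at (bvp n m) x"
proof -
  define s where "s = sc m - sc n"
  define t where "t = 1 + e m n * (d (Suc m) / s)"
  have "bvp n m = (\<lambda>x. 1 / t * e m x + e m n / s / t * sc x + - (e m n * sc m / s / t))"
    unfolding bvp_def s_def[symmetric] t_def[symmetric]
    by (simp add: fun_eq_iff diff_divide_distrib right_diff_distrib mult.commute)
  then show ?thesis by (simp only: harmonic_at_affine[OF harmonic_at_e harmonic_at_sc[OF assms(2)]])
qed

definition G :: "nat \<Rightarrow> nat \<Rightarrow> real" where "G n m = bvp n m (Suc n)"

text \<open>Separates a local term \<open>e m (Suc n) - e m n\<close>, alternating in sign and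
  geometrically small in \<open>m - n\<close>, from the main term
  \<open>e m n / S n m\<close>.\<close>

lemma G_eq:
  assumes "n < m"
  shows "G n m = (e m (Suc n) - e m n + e m n / S n m) / (1 + e m n * (d (Suc m) / (sc m - sc n)))"
proof -
  have "(sc m - sc (Suc n)) / (sc m - sc n) = 1 - 1 / S n m"
    using sc_less[OF assms] d_pos[of "Suc n"] by (simp add: S_def sc_Suc field_simps)
  then show ?thesis
    unfolding G_def bvp_def by (simp add: right_diff_distrib)
qed

text \<open>The local term and the replacement of \<open>e m n\<close> by \<open>e m 0\<close> each
  cost at most one ratio \<open>w (Suc n) / w (Suc m)\<close>, hence the factor 2. With
  \<open>e m 0\<close> the main term can be compared with \<open>avoid {m}\<close>.\<close>

lemma G_upper:
  assumes "n \<ge> 1" "n < m"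
  shows "G n m \<le> e m 0 / S n m + 2 * (1 / (1 + a 1 / 3)) ^ (m - n)"
proof -
  define t where "t = 1 + e m n * (d (Suc m) / (sc m - sc n))"
  define \<epsilon> where "\<epsilon> = w (Suc n) / w (Suc m)"
  have t: "1 \<le> t" using bvp_denominator[OF assms(2)] by (simp add: t_def)
  have \<epsilon>: "0 \<le> \<epsilon>" "\<epsilon> \<le> (1 / (1 + a 1 / 3)) ^ (m - n)"
    using w_ratio[OF assms(1), of "m - n"] assms w_nonneg by (auto simp: \<epsilon>_def)
  have "\<bar>e m (Suc n) - e m n\<bar> = \<epsilon>"
    using w_nonneg by (simp add: e_Suc_diff \<epsilon>_def abs_mult)
  moreover have "e m n \<le> e m 0 + \<epsilon>"
    using e_0_diff[of m n] w_Suc_ge[of n] w_pos[of "Suc m"] divide_right_mono[of "w n" "w (Suc n)" "w (Suc m)"]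
    unfolding \<epsilon>_def by linarith
  then have "e m n / S n m \<le> (e m 0 + \<epsilon>) / S n m"
    using S_ge_1[OF assms(2)] by (intro divide_right_mono) auto
  moreover have "\<epsilon> / S n m \<le> \<epsilon>"
    using S_ge_1[OF assms(2)] \<epsilon> frac_le[of \<epsilon> \<epsilon> 1 "S n m"] by simp
  ultimately have num: "e m (Suc n) - e m n + e m n / S n m \<le> e m 0 / S n m + 2 * \<epsilon>"
    by (simp add: add_divide_distrib)
  moreover have "0 \<le> e m 0 / S n m + 2 * \<epsilon>"
    using e_nonneg[of 0 m] S_ge_1[OF assms(2)] \<epsilon> by simp
  ultimately have "G n m \<le> e m 0 / S n m + 2 * \<epsilon>"
    unfolding G_eq[OF assms(2)] t_def[symmetric] using t
    by (smt (verit, best) divide_le_eq_1 divide_right_mono frac_le div_by_1)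
  then show ?thesis using \<epsilon> by linarith
qed

lemma G_lower:
  assumes "n \<ge> 1" "n < m" "even (m + n)" "m \<ge> 3"
  shows "a 1 / 54 / S n m \<le> G n m"
proof -
  define t where "t = 1 + e m n * (d (Suc m) / (sc m - sc n))"
  have t: "1 \<le> t" using bvp_denominator[OF assms(2)] by (simp add: t_def)
  have "d (Suc m) \<le> sc m - sc n"
    using d_antimono[of "Suc n" "Suc m"] sc_mono[of "Suc n" m] assms by (simp add: sc_Suc)
  then have "d (Suc m) / (sc m - sc n) \<le> 1" using sc_less[OF assms(2)] by simp
  then have "t \<le> 2"
    using mult_mono[of "e m n" 1 "d (Suc m) / (sc m - sc n)" 1] e_nonneg[of n m] e_le_1[of n m]
      assms d_pos[of "Suc m"] sc_less[OF assms(2)] by (simp add: t_def)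
  have S: "1 \<le> S n m" using S_ge_1[OF assms(2)] .
  have "e m (Suc n) - e m n \<ge> 0"
    using assms(3) w_nonneg by (simp add: e_Suc_diff)
  moreover have "a 1 / 27 / S n m \<le> e m n / S n m"
    using e_ge[of n m] assms S by (intro divide_right_mono) auto
  ultimately have num: "a 1 / 27 / S n m \<le> e m (Suc n) - e m n + e m n / S n m" by linarith
  have "0 \<le> a 1 / 27 / S n m" using a_pos[of 1] S by simp
  then have "a 1 / 27 / S n m / 2 \<le> (e m (Suc n) - e m n + e m n / S n m) / t"
    using num t \<open>t \<le> 2\<close> by (intro frac_le) auto
  then show ?thesis unfolding G_eq[OF assms(2)] t_def[symmetric] by simp
qed

text \<open>Boundary value solutions with zeros at a finite set of sites glue along each zero, because
  a downward step never jumps over a site and the only way up without hitting it is via its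
  successor.\<close>

definition entry :: "nat set \<Rightarrow> nat \<Rightarrow> (nat \<Rightarrow> real) \<Rightarrow> bool" where
  "entry B n g \<longleftrightarrow> (\<forall>x\<in>insert n B. g x = 0) \<and> g (Suc n) = 1 \<and> (\<forall>x<n. x \<notin> B \<longrightarrow> harmonic_at g x)"

lemma entry_empty: "entry {} n (e n)"
  by (simp add: entry_def e_self e_Suc_self harmonic_at_e)

lemma entry_insert:
  assumes g: "entry B n g" and nm: "n < m" and B: "B \<subseteq> {..<n}"
  shows "entry (insert n B) m (\<lambda>x. if x \<le> n then G n m * g x else bvp n m x)"
proof -
  define f where "f x = (if x \<le> n then G n m * g x else bvp n m x)" for x
  \<comment> \<open>Both branches are 0 at \<open>n\<close> and \<open>G n m\<close> at
    \<open>n + 1\<close>. So each formula extends to the sites that a step out of its range can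
    reach: \<open>x + 2 \<le> n + 1\<close> for \<open>x < n\<close>, and
    \<open>x - 1 \<ge> n\<close> for \<open>x > n\<close>.\<close>
  have le: "f y = G n m * g y" if "y \<le> Suc n" for y
    using that g by (cases "y = Suc n") (auto simp: entry_def G_def f_def)
  have ge: "f y = bvp n m y" if "y \<ge> n" for y
    using that g nm by (cases "y = n") (auto simp: entry_def bvp_left f_def)
  have "entry (insert n B) m f"
    unfolding entry_def
  proof (intro conjI ballI allI impI)
    fix x assume "x \<in> insert m (insert n B)"
    then show "f x = 0" using g B nm by (auto simp: entry_def bvp_right f_def)
  next
    show "f (Suc m) = 1" using nm bvp_Suc_right[OF nm] by (simp add: f_def)
  next
    fix x assume x: "x < m" "x \<notin> insert n B"
    show "harmonic_at f x"
    proof (cases "x < n")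
      case True
      then have "harmonic_at g x" using g x by (simp add: entry_def)
      then have "harmonic_at (\<lambda>y. G n m * g y) x"
        using harmonic_at_affine[of g x g "G n m" 0 0] by simp
      then show ?thesis
        by (subst harmonic_at_cong[where g = "\<lambda>y. G n m * g y"]) (use True in \<open>auto intro!: le\<close>)
    next
      case False
      then have "harmonic_at (bvp n m) x" using harmonic_at_bvp[OF nm] x by auto
      then show ?thesis
        by (subst harmonic_at_cong[where g = "bvp n m"]) (use False x in \<open>auto intro!: ge\<close>)
    qed
  qed
  then show ?thesis by (simp add: f_def[abs_def])
qed

lemma entry_exists:
  assumes "finite B" "B \<subseteq> {..<n}"
  shows "\<exists>g. entry B n g"
  using assms
proof (induction B arbitrary: n rule: finite_linorder_max_induct)
  case empty
  then show ?case using entry_empty by blast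
next
  case (insert b A)
  then obtain g where "entry A b g" by (metis lessThan_iff subsetI)
  then show ?case using entry_insert[of A b g n] insert by blast
qed

end

section \<open>Avoidance probabilities\<close>

context prob_space
begin

text \<open>Used with \<open>Y\<close> the list of the first states, to pass from the Markov
  property of full histories to coarser events.\<close>

lemma prob_countable_partition:
  fixes Y :: "'a \<Rightarrow> 'b::countable"
  assumes Y: "Y \<in> M \<rightarrow>\<^sub>M count_space UNIV" and E: "E \<in> events" and F: "F \<in> events"
    and eq: "\<And>y. prob (E \<inter> {\<omega> \<in> space M. Y \<omega> = y}) = c * prob (F \<inter> {\<omega> \<in> space M. Y \<omega> = y})"
  shows "prob E = c * prob F"
proof -
  have "(\<lambda>n. prob (A \<inter> {\<omega> \<in> space M. to_nat (Y \<omega>) = n})) sums prob A" if "A \<in> events" for A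
  proof -
    have [measurable]: "A \<in> events" "Y \<in> M \<rightarrow>\<^sub>M count_space UNIV" using that Y by auto
    have "(\<lambda>n. prob (A \<inter> {\<omega> \<in> space M. to_nat (Y \<omega>) = n}))
        sums prob (\<Union>n. A \<inter> {\<omega> \<in> space M. to_nat (Y \<omega>) = n})"
      by (intro finite_measure_UNION) (auto simp: disjoint_family_on_def)
    also have "(\<Union>n. A \<inter> {\<omega> \<in> space M. to_nat (Y \<omega>) = n}) = A"
      using sets.sets_into_space[OF that] by auto
    finally show ?thesis .
  qed
  note sums = this[OF E] this[OF F]
  have "prob (E \<inter> {\<omega> \<in> space M. to_nat (Y \<omega>) = n})
      = c * prob (F \<inter> {\<omega> \<in> space M. to_nat (Y \<omega>) = n})" for n
  \<comment> \<open>\<open>to_nat\<close> need not be onto; indices outside its range give empty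
    events.\<close>
  proof (cases "n \<in> range (to_nat :: 'b \<Rightarrow> nat)")
    case True
    then obtain y :: 'b where "n = to_nat y" by auto
    then show ?thesis using eq[of y] by simp
  next
    case False
    then have "{\<omega> \<in> space M. to_nat (Y \<omega>) = n} = {}" by auto
    then show ?thesis by (simp only: Int_empty_right measure_empty mult_zero_right)
  qed
  then show ?thesis using sums_unique2[OF sums(1)] sums_mult[OF sums(2), of c] by simp
qed

end

section \<open>The Markov property and the walk killed on a set\<close>

locale skipping_chain = drifted_walk +
  fixes M :: "'w measure" and X :: "nat \<Rightarrow> 'w \<Rightarrow> nat"
  assumes chain: "markov_chain M X 0 (walk_transition p q)"

sublocale skipping_chain \<subseteq> prob_space M
  using chain by (simp add: markov_chain_def)

context skipping_chain
begin

lemma X_measurable[measurable]: "X k \<in> M \<rightarrow>\<^sub>M count_space UNIV"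
  using chain by (simp add: markov_chain_def)

lemma X_0: "AE \<omega> in M. X 0 \<omega> = 0"
  using chain by (simp add: markov_chain_def)

text \<open>On a history of positive probability that avoids \<open>B\<close> and ends in
  \<open>x\<close> the chain property gives the factor; on null histories both sides are 0, and on
  all others both events are empty.\<close>

lemma markov_step:
  "\<P>(\<omega> in M. (\<forall>l\<le>k. X l \<omega> \<notin> B) \<and> X k \<omega> = x \<and> X (Suc k) \<omega> = y)
     = walk_transition p q x y * \<P>(\<omega> in M. (\<forall>l\<le>k. X l \<omega> \<notin> B) \<and> X k \<omega> = x)"
proof (rule prob_countable_partition[where Y = "\<lambda>\<omega>. map (\<lambda>l. X l \<omega>) [0..<Suc k]"])
  show "(\<lambda>\<omega>. map (\<lambda>l. X l \<omega>) [0..<Suc k]) \<in> M \<rightarrow>\<^sub>M count_space UNIV"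
  proof (intro measurable_count_space_eq_countable[THEN iffD2] conjI ballI)
    fix h :: "nat list"
    have "(\<lambda>\<omega>. map (\<lambda>l. X l \<omega>) [0..<Suc k]) -` {h} \<inter> space M
      = {\<omega> \<in> space M. length h = Suc k \<and> (\<forall>l<Suc k. X l \<omega> = h ! l)}"
      by (auto simp: list_eq_iff_nth_eq simp del: upt_Suc)
    also have "\<dots> \<in> events" by measurable
    finally show "(\<lambda>\<omega>. map (\<lambda>l. X l \<omega>) [0..<Suc k]) -` {h} \<inter> space M \<in> events" .
  qed auto
next
  fix h :: "nat list"
  define z where "z l = h ! l" for l
  let ?H = "{\<omega> \<in> space M. map (\<lambda>l. X l \<omega>) [0..<Suc k] = h}"
  let ?E = "{\<omega> \<in> space M. (\<forall>l\<le>k. X l \<omega> \<notin> B) \<and> X k \<omega> = x \<and> X (Suc k) \<omega> = y}"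
  let ?F = "{\<omega> \<in> space M. (\<forall>l\<le>k. X l \<omega> \<notin> B) \<and> X k \<omega> = x}"
  show "prob (?E \<inter> ?H) = walk_transition p q x y * prob (?F \<inter> ?H)"
  proof (cases "length h = Suc k \<and> (\<forall>l\<le>k. z l \<notin> B) \<and> z k = x")
    case True
    have H: "?H = {\<omega> \<in> space M. \<forall>l\<le>k. X l \<omega> = z l}"
      using True by (auto simp: list_eq_iff_nth_eq z_def less_Suc_eq_le simp del: upt_Suc)
    then have F: "?F \<inter> ?H = {\<omega> \<in> space M. \<forall>l\<le>k. X l \<omega> = z l}"
      and E: "?E \<inter> ?H = {\<omega> \<in> space M. X (Suc k) \<omega> = y \<and> (\<forall>l\<le>k. X l \<omega> = z l)}"
      using True by auto
    show ?thesis
    proof (cases "prob (?F \<inter> ?H) = 0")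
      case zero: True
      have "prob (?E \<inter> ?H) \<le> prob (?F \<inter> ?H)"
        unfolding E F by (intro finite_measure_mono) auto
      then have "prob (?E \<inter> ?H) = 0" using zero measure_nonneg[of M "?E \<inter> ?H"] by linarith
      then show ?thesis by (simp only: zero mult_zero_right)
    next
      case False
      then have "\<P>(\<omega> in M. X (Suc k) \<omega> = y \<bar> \<forall>l\<le>k. X l \<omega> = z l) = walk_transition p q x y"
        using chain True unfolding markov_chain_def F by blast
      then show ?thesis using False unfolding cond_prob_def E F by (simp add: field_simps)
    qed
  next
    case False
    have "?E \<inter> ?H = {}" "?F \<inter> ?H = {}"
      using False by (auto simp: z_def simp del: upt_Suc)
    then show ?thesis by simp
  qed
qed measurable

text \<open>Law at time \<open>k\<close> of the walk killed on entering \<open>B\<close>.\<close>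

definition mass :: "nat set \<Rightarrow> nat \<Rightarrow> nat \<Rightarrow> real" where
  "mass B k x = \<P>(\<omega> in M. (\<forall>l\<le>k. X l \<omega> \<notin> B) \<and> X k \<omega> = x)"

lemma mass_nonneg: "0 \<le> mass B k x"
  by (simp add: mass_def)

text \<open>Makes every sum over the states at time \<open>k\<close> finite.\<close>

lemma AE_X_le: "AE \<omega> in M. X k \<omega> \<le> 2 * k"
proof (induction k)
  case 0
  then show ?case using X_0 by auto
next
  case (Suc k)
  have "AE \<omega> in M. \<not> (X k \<omega> = x \<and> X (Suc k) \<omega> = y)" if "x + 2 < y" for x y
  proof -
    have "\<P>(\<omega> in M. X k \<omega> = x \<and> X (Suc k) \<omega> = y) = 0"
      using markov_step[of k "{}" x y] that by (auto simp: walk_transition_def)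
    then show ?thesis by (subst (asm) prob_eq_0) auto
  qed
  then have "AE \<omega> in M. \<forall>x y. x + 2 < y \<longrightarrow> \<not> (X k \<omega> = x \<and> X (Suc k) \<omega> = y)"
    unfolding AE_all_countable by (auto intro: AE_impI)
  with Suc show ?case
  proof eventually_elim
    case (elim \<omega>)
    then have "\<not> X k \<omega> + 2 < X (Suc k) \<omega>" by blast
    then show ?case using elim(1) by simp
  qed
qed

lemma mass_eq_0: "2 * k < x \<Longrightarrow> mass B k x = 0"
  unfolding mass_def by (subst prob_eq_0) (use AE_X_le[of k] in auto)

lemma mass_in: "x \<in> B \<Longrightarrow> mass B k x = 0"
proof -
  assume "x \<in> B"
  then have "{\<omega> \<in> space M. (\<forall>l\<le>k. X l \<omega> \<notin> B) \<and> X k \<omega> = x} = {}" by auto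
  then show ?thesis by (simp only: mass_def measure_empty)
qed

lemma mass_0:
  assumes "0 \<notin> B"
  shows "mass B 0 x = (if x = 0 then 1 else 0)"
proof -
  have "mass B 0 x = \<P>(\<omega> in M. x = 0)"
    unfolding mass_def by (intro prob_eq_AE) (use X_0 assms in \<open>auto elim!: AE_mp\<close>)
  then show ?thesis by (simp add: prob_space)
qed

lemma sum_mass_eq:
  fixes A :: "'w \<Rightarrow> bool"
  assumes [measurable]: "Measurable.pred M A"
  shows "\<P>(\<omega> in M. A \<omega>) = (\<Sum>x\<le>2*k. \<P>(\<omega> in M. A \<omega> \<and> X k \<omega> = x))"
proof -
  have "\<P>(\<omega> in M. A \<omega>) = \<P>(\<omega> in M. A \<omega> \<and> X k \<omega> \<in> {..2*k})"
    by (intro prob_eq_AE) (use AE_X_le[of k] in auto)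
  also have "{\<omega> \<in> space M. A \<omega> \<and> X k \<omega> \<in> {..2*k}}
      = (\<Union>x\<in>{..2*k}. {\<omega> \<in> space M. A \<omega> \<and> X k \<omega> = x})"
    by auto
  also have "prob \<dots> = (\<Sum>x\<le>2*k. \<P>(\<omega> in M. A \<omega> \<and> X k \<omega> = x))"
    by (intro finite_measure_finite_Union) (auto simp: disjoint_family_on_def)
  finally show ?thesis .
qed

lemma mass_Suc:
  assumes "y \<notin> B"
  shows "mass B (Suc k) y = (\<Sum>x\<le>2*k. mass B k x * walk_transition p q x y)"
proof -
  have "mass B (Suc k) y = \<P>(\<omega> in M. (\<forall>l\<le>k. X l \<omega> \<notin> B) \<and> X (Suc k) \<omega> = y)"
    unfolding mass_def by (rule arg_cong[where f = prob]) (use assms in \<open>auto simp: le_Suc_eq\<close>)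
  also have "\<dots> = (\<Sum>x\<le>2*k. \<P>(\<omega> in M. ((\<forall>l\<le>k. X l \<omega> \<notin> B) \<and> X (Suc k) \<omega> = y) \<and> X k \<omega> = x))"
    by (rule sum_mass_eq) measurable
  also have "\<dots> = (\<Sum>x\<le>2*k. mass B k x * walk_transition p q x y)"
  proof (intro sum.cong refl)
    fix x
    have "mass B k x * walk_transition p q x y
        = \<P>(\<omega> in M. (\<forall>l\<le>k. X l \<omega> \<notin> B) \<and> X k \<omega> = x \<and> X (Suc k) \<omega> = y)"
      unfolding mass_def markov_step by (rule mult.commute)
    then show "\<P>(\<omega> in M. ((\<forall>l\<le>k. X l \<omega> \<notin> B) \<and> X (Suc k) \<omega> = y) \<and> X k \<omega> = x)
        = mass B k x * walk_transition p q x y"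
      by (simp only: conj_assoc conj_commute[of "X (Suc k) _ = y"])
  qed
  finally show ?thesis .
qed

lemma walk_transition_sum:
  fixes f :: "nat \<Rightarrow> real"
  assumes "x + 2 \<le> N"
  shows "(\<Sum>y\<le>N. walk_transition p q x y * f y)
    = (if x = 0 then f 2 else p x * f (x + 2) + q x * f (x - 1))"
proof (cases "x = 0")
  case True
  then have "(\<Sum>y\<le>N. walk_transition p q x y * f y) = (\<Sum>y\<le>N. if y = 2 then f y else 0)"
    by (intro sum.cong) (auto simp: walk_transition_def)
  then show ?thesis using True assms by (simp add: sum.delta)
next
  case False
  then have "(\<Sum>y\<le>N. walk_transition p q x y * f y)
      = (\<Sum>y\<le>N. (if y = x + 2 then p x * f y else 0) + (if y = x - 1 then q x * f y else 0))"
    by (intro sum.cong) (auto simp: walk_transition_def)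
  then show ?thesis using False assms by (simp add: sum.distrib sum.delta)
qed

text \<open>Optional stopping at the hitting time of \<open>B\<close>.\<close>

lemma mass_harmonic:
  assumes B: "0 \<notin> B" and zero: "\<And>x. x \<in> B \<Longrightarrow> f x = 0" and harm: "\<And>x. x \<notin> B \<Longrightarrow> harmonic_at f x"
  shows "(\<Sum>x\<le>2*k. mass B k x * f x) = f 0"
proof (induction k)
  case 0
  then show ?case using mass_0[OF B] by simp
next
  case (Suc k)
  have "(\<Sum>y\<le>2 * Suc k. mass B (Suc k) y * f y)
      = (\<Sum>y\<le>2 * Suc k. \<Sum>x\<le>2*k. mass B k x * (walk_transition p q x y * f y))"
  proof (intro sum.cong refl)
    fix y
    show "mass B (Suc k) y * f y = (\<Sum>x\<le>2*k. mass B k x * (walk_transition p q x y * f y))"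
      using zero[of y] by (cases "y \<in> B") (simp_all add: mass_Suc sum_distrib_right mult.assoc)
  qed
  also have "\<dots> = (\<Sum>x\<le>2*k. \<Sum>y\<le>2 * Suc k. mass B k x * (walk_transition p q x y * f y))"
    by (rule sum.swap)
  also have "\<dots> = (\<Sum>x\<le>2*k. mass B k x * f x)"
  proof (intro sum.cong refl)
    fix x assume x: "x \<in> {..2*k}"
    have "(\<Sum>y\<le>2 * Suc k. mass B k x * (walk_transition p q x y * f y))
        = mass B k x * (if x = 0 then f 2 else p x * f (x + 2) + q x * f (x - 1))"
      using walk_transition_sum[of x "2 * Suc k" f] x
      by (simp only: sum_distrib_left[symmetric]) simp
    also have "\<dots> = mass B k x * f x"
      using harm[of x] mass_in[of x B k] by (cases "x \<in> B") (auto simp: harmonic_at_def split: if_splits)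
    finally show "(\<Sum>y\<le>2 * Suc k. mass B k x * (walk_transition p q x y * f y)) = mass B k x * f x" .
  qed
  finally show ?case using Suc by simp
qed

definition total :: "nat set \<Rightarrow> nat \<Rightarrow> real" where
  "total B k = \<P>(\<omega> in M. \<forall>l\<le>k. X l \<omega> \<notin> B)"

lemma total_eq_sum: "total B k = (\<Sum>x\<le>2*k. mass B k x)"
  unfolding total_def mass_def by (rule sum_mass_eq) measurable

lemma total_le_1: "total B k \<le> 1"
  by (simp add: total_def)

lemma total_drop:
  assumes "y \<in> B"
  shows "mass B k x * walk_transition p q x y \<le> total B k - total B (Suc k)"
proof -
  have "mass B k x * walk_transition p q x y
      = \<P>(\<omega> in M. (\<forall>l\<le>k. X l \<omega> \<notin> B) \<and> X k \<omega> = x \<and> X (Suc k) \<omega> = y)"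
    unfolding mass_def by (simp add: markov_step)
  also have "\<dots> \<le> prob ({\<omega> \<in> space M. \<forall>l\<le>k. X l \<omega> \<notin> B} - {\<omega> \<in> space M. \<forall>l\<le>Suc k. X l \<omega> \<notin> B})"
    using assms by (intro finite_measure_mono) auto
  also have "\<dots> = total B k - total B (Suc k)"
    unfolding total_def by (intro finite_measure_Diff) auto
  finally show ?thesis .
qed

lemma walk_transition_nonneg: "0 \<le> walk_transition p q x y"
  using p_pos[of x] q_pos[of x] by (auto simp: walk_transition_def)

text \<open>The series over \<open>k\<close> is the expected number of visits to \<open>x\<close>
  before \<open>B\<close> is hit. Each visit moves on to \<open>y\<close> with a fixed positive
  probability. If \<open>y\<close> is in \<open>B\<close> this kills the walk, and the losses of
  survival probability telescope; otherwise it is a visit to \<open>y\<close>.\<close>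

lemma summable_mass_step:
  assumes y: "y \<in> B \<or> summable (\<lambda>k. mass B k y)" and P: "0 < walk_transition p q x y"
  shows "summable (\<lambda>k. mass B k x)"
proof -
  have "summable (\<lambda>k. mass B k x * walk_transition p q x y)"
  proof (cases "y \<in> B")
    case True
    show ?thesis
    proof (rule bounded_imp_summable)
      fix n
      have "(\<Sum>k\<le>n. mass B k x * walk_transition p q x y) \<le> (\<Sum>k\<le>n. total B k - total B (Suc k))"
        by (intro sum_mono total_drop True)
      also have "\<dots> = total B 0 - total B (Suc n)"
        by (rule sum_telescope)
      also have "\<dots> \<le> 1"
        using total_le_1[of B 0] measure_nonneg[of M "{\<omega> \<in> space M. \<forall>l\<le>Suc n. X l \<omega> \<notin> B}"]
        unfolding total_def by linarith
      finally show "(\<Sum>k\<le>n. mass B k x * walk_transition p q x y) \<le> 1" .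
    qed (simp add: mass_nonneg walk_transition_nonneg)
  next
    case False
    then have "summable (\<lambda>k. mass B (Suc k) y)" using y summable_Suc_iff[of "\<lambda>k. mass B k y"] by blast
    then show ?thesis
    proof (rule summable_comparison_test')
      fix k
      show "norm (mass B k x * walk_transition p q x y) \<le> mass B (Suc k) y"
      proof (cases "x \<le> 2 * k")
        case True
        then show ?thesis
          unfolding mass_Suc[OF False]
          using member_le_sum[of x "{..2*k}" "\<lambda>x. mass B k x * walk_transition p q x y"]
          by (simp add: mass_nonneg walk_transition_nonneg)
      qed (simp add: mass_eq_0 mass_nonneg)
    qed
  qed
  from summable_divide[OF this, of "walk_transition p q x y"] show ?thesis using P by simp
qed

text \<open>From every site the walk reaches \<open>B\<close> along a path of positive probability.\<close>

lemma summable_mass: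
  assumes b: "b \<in> B" "b \<ge> 1"
  shows "summable (\<lambda>k. mass B k x)"
proof -
  have down: "x \<in> B \<or> summable (\<lambda>k. mass B k x)" if "b \<le> x" for x
    using that
  proof (induction x rule: dec_induct)
    case (step x)
    have "0 < walk_transition p q (Suc x) x" using q_pos[of "Suc x"] by (simp add: walk_transition_def)
    then show ?case using summable_mass_step step.IH by blast
  qed (use b in simp)
  \<comment> \<open>Below \<open>b\<close>, upward jumps lead to some site at or above
    \<open>b\<close>, from which unit steps down cannot miss \<open>b\<close>; \<open>j\<close>
    bounds the distance still to climb.\<close>
  have up: "x + j \<ge> b \<Longrightarrow> x \<in> B \<or> summable (\<lambda>k. mass B k x)" for x j
  proof (induction j arbitrary: x)
    case 0
    then show ?case using down by simp
  next
    case (Suc j)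
    have "0 < walk_transition p q x (x + 2)" using p_pos[of x] by (simp add: walk_transition_def)
    moreover have "x + 2 \<in> B \<or> summable (\<lambda>k. mass B k (x + 2))" using Suc by simp
    ultimately show ?case using summable_mass_step by blast
  qed
  show ?thesis using up[of x b] mass_in[of x B] by auto
qed

section \<open>Avoidance probabilities from optional stopping in the limit of large times\<close>

definition avoid :: "nat set \<Rightarrow> real" where
  "avoid B = \<P>(\<omega> in M. \<forall>b\<in>B. b \<in> skipped_points X \<omega>)"

lemma skipped_iff: "b \<in> skipped_points X \<omega> \<longleftrightarrow> (\<forall>n. X n \<omega> \<noteq> b)"
  by (auto simp: skipped_points_def)

lemma skipped_measurable[measurable]: "Measurable.pred M (\<lambda>\<omega>. b \<in> skipped_points X \<omega>)"
  unfolding skipped_iff by measurable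

lemma total_tendsto: "total B \<longlonglongrightarrow> avoid B"
proof -
  have "(\<lambda>k. prob {\<omega> \<in> space M. \<forall>l\<le>k. X l \<omega> \<notin> B})
      \<longlonglongrightarrow> prob (\<Inter>k. {\<omega> \<in> space M. \<forall>l\<le>k. X l \<omega> \<notin> B})"
    by (intro finite_Lim_measure_decseq) (auto simp: decseq_def)
  also have "(\<Inter>k. {\<omega> \<in> space M. \<forall>l\<le>k. X l \<omega> \<notin> B})
      = {\<omega> \<in> space M. \<forall>b\<in>B. b \<in> skipped_points X \<omega>}"
    by (auto simp: skipped_iff)
  finally show ?thesis by (simp add: avoid_def total_def[abs_def])
qed

text \<open>With finitely many expected visits to each site, the surviving walk leaves every bounded
  set, so only the values of a test function far out count.\<close>

lemma small_mass_tendsto: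
  assumes "b \<in> B" "b \<ge> 1"
  shows "(\<lambda>k. \<Sum>x<L. mass B k x * c x) \<longlonglongrightarrow> 0"
  using tendsto_mult_left_zero[OF summable_LIMSEQ_zero[OF summable_mass[OF assms]]]
  by (intro tendsto_null_sum) auto

text \<open>One-sided version for test functions without a limit at infinity; it serves the
  recurrent case.\<close>

lemma avoid_le_harmonic:
  assumes B: "b \<in> B" "b \<ge> 1" "0 \<notin> B"
    and f: "\<And>x. x \<in> B \<Longrightarrow> f x = 0" "\<And>x. x \<notin> B \<Longrightarrow> harmonic_at f x" "\<And>x. 0 \<le> f x"
    and L: "\<And>x. L \<le> x \<Longrightarrow> 1 \<le> f x"
  shows "avoid B \<le> f 0"
proof (rule LIMSEQ_le[OF total_tendsto])
  show "(\<lambda>k. (\<Sum>x<L. mass B k x * 1) + f 0) \<longlonglongrightarrow> f 0"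
    using tendsto_add[OF small_mass_tendsto[OF B(1,2), where c = "\<lambda>_. 1"] tendsto_const[of "f 0"]] by simp
  show "\<exists>N. \<forall>k\<ge>N. total B k \<le> (\<Sum>x<L. mass B k x * 1) + f 0"
  proof (intro exI allI impI)
    fix k
    have "total B k \<le> (\<Sum>x\<le>2*k. (if x < L then mass B k x else 0) + mass B k x * f x)"
      unfolding total_eq_sum
    proof (intro sum_mono)
      fix x
      show "mass B k x \<le> (if x < L then mass B k x else 0) + mass B k x * f x"
        using mult_left_mono[OF L[of x] mass_nonneg[of B k x]]
          mult_nonneg_nonneg[OF mass_nonneg[of B k x] f(3)[of x]] by (cases "x < L") simp_all
    qed
    also have "\<dots> = (\<Sum>x\<le>2*k. if x < L then mass B k x else 0) + f 0"
      using mass_harmonic[OF B(3) f(1,2)] by (simp add: sum.distrib)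
    also have "(\<Sum>x\<le>2*k. if x < L then mass B k x else 0) = (\<Sum>x\<in>{..2*k} \<inter> {..<L}. mass B k x)"
      by (simp add: sum.inter_restrict)
    also have "\<dots> \<le> (\<Sum>x<L. mass B k x)"
      by (intro sum_mono2) (auto simp: mass_nonneg)
    finally show "total B k \<le> (\<Sum>x<L. mass B k x * 1) + f 0" by simp
  qed
qed

text \<open>By \<open>mass_harmonic\<close> the killed law integrates \<open>f\<close> to
  \<open>f 0\<close> at every time. That law moves out to infinity, where \<open>f\<close> is close
  to 1, so its total mass tends to \<open>f 0\<close> as well.\<close>

lemma avoid_eq_harmonic:
  assumes B: "b \<in> B" "b \<ge> 1" "0 \<notin> B"
    and f: "\<And>x. x \<in> B \<Longrightarrow> f x = 0" "\<And>x. x \<notin> B \<Longrightarrow> harmonic_at f x"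
    and lim: "f \<longlonglongrightarrow> 1"
  shows "avoid B = f 0"
proof (rule LIMSEQ_unique[OF total_tendsto])
  show "total B \<longlonglongrightarrow> f 0"
  proof (rule LIMSEQ_I)
    fix \<epsilon> :: real assume \<epsilon>: "0 < \<epsilon>"
    obtain L where L: "\<And>x. L \<le> x \<Longrightarrow> \<bar>1 - f x\<bar> < \<epsilon> / 2"
      using LIMSEQ_D[OF lim, of "\<epsilon> / 2"] \<epsilon> by (auto simp: abs_minus_commute)
    obtain N where N: "\<And>k. N \<le> k \<Longrightarrow> (\<Sum>x<L. mass B k x * \<bar>1 - f x\<bar>) < \<epsilon> / 2"
      using order_tendstoD(2)[OF small_mass_tendsto[OF B(1,2),
          where L = L and c = "\<lambda>x. \<bar>1 - f x\<bar>"], of "\<epsilon> / 2"] \<epsilon>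
      unfolding eventually_sequentially by auto
    show "\<exists>N. \<forall>k\<ge>N. norm (total B k - f 0) < \<epsilon>"
    proof (intro exI allI impI)
      fix k assume k: "N \<le> k"
      have "\<bar>total B k - f 0\<bar> = \<bar>\<Sum>x\<le>2*k. mass B k x * (1 - f x)\<bar>"
        using mass_harmonic[OF B(3) f, of k] by (simp add: total_eq_sum right_diff_distrib sum_subtractf)
      also have "\<dots> \<le> (\<Sum>x\<le>2*k. mass B k x * \<bar>1 - f x\<bar>)"
        by (rule order_trans[OF sum_abs]) (simp add: abs_mult mass_nonneg)
      also have "\<dots> \<le> (\<Sum>x\<le>2*k. (if x < L then mass B k x * \<bar>1 - f x\<bar> else 0) + mass B k x * (\<epsilon> / 2))"
      proof (intro sum_mono)
        fix x
        show "mass B k x * \<bar>1 - f x\<bar>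
          \<le> (if x < L then mass B k x * \<bar>1 - f x\<bar> else 0) + mass B k x * (\<epsilon> / 2)"
          using L[of x] mass_nonneg[of B k x] \<epsilon>
            mult_left_mono[of "\<bar>1 - f x\<bar>" "\<epsilon> / 2" "mass B k x"] by (cases "x < L") auto
      qed
      also have "\<dots> = (\<Sum>x\<in>{..2*k} \<inter> {..<L}. mass B k x * \<bar>1 - f x\<bar>) + total B k * (\<epsilon> / 2)"
        by (simp add: sum.distrib sum.inter_restrict total_eq_sum sum_distrib_right sum_divide_distrib)
      also have "\<dots> \<le> (\<Sum>x<L. mass B k x * \<bar>1 - f x\<bar>) + 1 * (\<epsilon> / 2)"
        using \<epsilon> by (intro add_mono sum_mono2 mult_right_mono) (auto simp: mass_nonneg total_le_1)
      also have "\<dots> < \<epsilon>" using N[OF k] by simp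
      finally show "norm (total B k - f 0) < \<epsilon>" by simp
    qed
  qed
qed

end

section \<open>\<open>D n\<close> as a rescaled tail of the scale function\<close>

context drifted_walk
begin

text \<open>Junk values unless \<open>d\<close> is summable, that is, unless the walk is transient.\<close>

definition \<Lambda> :: real where "\<Lambda> = (\<Sum>j. d (Suc j))"

definition Dr :: "nat \<Rightarrow> real" where "Dr n = (\<Lambda> - sc n) / d (Suc n)"

lemma sc_eq_sum: "sc x = (\<Sum>j<x. d (Suc j))"
  by (induction x) (simp_all add: sc_0 sc_Suc)

lemma sc_tendsto: "summable d \<Longrightarrow> sc \<longlonglongrightarrow> \<Lambda>"
  unfolding sc_eq_sum[abs_def] \<Lambda>_def
  using summable_Suc_iff[of d] by (intro summable_LIMSEQ) simp

lemma sc_less_\<Lambda>: "summable d \<Longrightarrow> sc n < \<Lambda>"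
  using incseq_le[OF _ sc_tendsto, of "Suc n"] sc_mono sc_less[of n "Suc n"]
  by (fastforce simp: incseq_def)

lemma S_le_Dr: "summable d \<Longrightarrow> S n m \<le> Dr n"
  using sc_less_\<Lambda>[of m] d_pos[of "Suc n"] by (simp add: S_def Dr_def divide_right_mono)

lemma Dr_ge_1: "summable d \<Longrightarrow> 1 \<le> Dr n"
  using S_le_Dr[of n "Suc n"] S_Suc_self by simp

lemma Dr_split: "Dr n = S n m + d (Suc m) / d (Suc n) * Dr m"
proof -
  have "d (Suc m) / d (Suc n) * Dr m = (\<Lambda> - sc m) / d (Suc n)"
    using d_pos[of "Suc m"] by (simp add: Dr_def)
  then show ?thesis by (simp only: S_def) (simp add: Dr_def diff_divide_distrib)
qed

lemma Dr_le_add: "summable d \<Longrightarrow> Dr n \<le> real j + Dr (n + j)"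
  using Dr_split[of n "n + j"] S_le[of n j] d_antimono[of "Suc n" "Suc (n + j)"] d_pos[of "Suc n"]
    mult_right_mono[of "d (Suc (n + j)) / d (Suc n)" 1 "Dr (n + j)"] Dr_ge_1[of "n + j"] by simp

lemma sc_unbounded:
  assumes "\<not> summable d"
  shows "\<exists>N. \<forall>n\<ge>N. B \<le> sc n"
proof (rule ccontr)
  assume *: "\<not> ?thesis"
  have le: "sc n \<le> B" for n
  proof -
    obtain m where "n \<le> m" "sc m < B" using * by (auto simp: not_le)
    then show ?thesis using sc_mono[of n m] by simp
  qed
  have "summable (\<lambda>j. d (Suc j))"
    using le[of "Suc _"] less_imp_le[OF d_pos]
    by (intro bounded_imp_summable[of _ B]) (auto simp only: sc_eq_sum lessThan_Suc_atMost)
  then show False using assms summable_Suc_iff[of d] by simp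
qed

lemma D_lim_eq_lim_S: "D_lim U m = lim (\<lambda>n. ennreal (S m n))"
proof -
  have prod: "(\<Prod>i=m+1..j-1. U i) = d j / d (Suc m)" if "Suc m \<le> j" for j
    using that
  proof (induction j rule: dec_induct)
    case base
    then show ?case using d_pos[of "Suc m"] by simp
  next
    case (step j)
    have "(\<Prod>i=m+1..Suc j-1. U i) = U j * (\<Prod>i=m+1..j-1. U i)"
      using step(1) by (cases j) (auto simp: mult.commute)
    then show ?case using step d_Suc[of j] by simp
  qed
  have "(\<Sum>j=m+1..n. ennreal (\<Prod>i=m+1..j-1. U i)) = ennreal (S m n)" if "m \<le> n" for n
  proof -
    have "(\<Sum>j=m+1..n. ennreal (\<Prod>i=m+1..j-1. U i)) = ennreal (\<Sum>j=m+1..n. d j / d (Suc m))"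
      using prod d_pos[THEN less_imp_le] by (subst sum_ennreal[symmetric]) (auto intro!: sum.cong)
    also have "(\<Sum>j=m+1..n. d j / d (Suc m)) = S m n"
      using that by (induction n rule: dec_induct) (auto simp: S_Suc, simp add: S_def)
    finally show ?thesis .
  qed
  then have "\<forall>\<^sub>F n in sequentially. (\<Sum>j=m+1..n. ennreal (\<Prod>i=m+1..j-1. U i)) = ennreal (S m n)"
    by (auto intro: eventually_sequentiallyI[of m])
  \<comment> \<open>\<open>lim\<close> depends only on which values are limits, so eventual equality
    suffices before convergence is known.\<close>
  from tendsto_cong[OF this] show ?thesis
    unfolding D_lim_def lim_def by presburger
qed

lemma D_lim_summable:
  assumes "summable d"
  shows "D_lim U m = ennreal (Dr m)"
  unfolding D_lim_eq_lim_S S_def Dr_def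
  using d_pos[of "Suc m"]
  by (intro limI tendsto_ennrealI tendsto_intros sc_tendsto[OF assms]) auto

lemma D_lim_not_summable:
  assumes "\<not> summable d"
  shows "D_lim U m = \<infinity>"
proof -
  have "filterlim (\<lambda>n. S m n) at_top sequentially"
    unfolding filterlim_at_top
  proof
    fix Z :: real
    obtain N where "\<forall>n\<ge>N. Z * d (Suc m) + sc m \<le> sc n" using sc_unbounded[OF assms] by blast
    then show "\<forall>\<^sub>F n in sequentially. Z \<le> S m n"
      using d_pos[of "Suc m"]
      by (intro eventually_sequentiallyI[of N]) (simp add: S_def pos_le_divide_eq algebra_simps)
  qed
  then have "((\<lambda>n. ennreal (S m n)) \<longlongrightarrow> \<infinity>) sequentially"
    unfolding infinity_ennreal_def ennreal_tendsto_top_eq_at_top .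
  then show ?thesis unfolding D_lim_eq_lim_S by (rule limI)
qed

end

section \<open>Avoidance probabilities in the transient and the recurrent case\<close>

context skipping_chain
begin

text \<open>Below \<open>m\<close> the test function is \<open>g / Dr m\<close>, above it the
  probability \<open>(sc x - sc m) / (\<Lambda> - sc m)\<close> of never coming down to
  \<open>m\<close>. Both are 0 at \<open>m\<close> and \<open>1 / Dr m\<close> at
  \<open>m + 1\<close>, so they glue to a function with limit 1 that is harmonic off
  \<open>insert m B\<close>.\<close>

lemma avoid_insert:
  assumes sm: "summable d" and g: "entry B m g" and B: "B \<subseteq> {1..<m}" "m \<ge> 1"
  shows "avoid (insert m B) = g 0 / Dr m"
proof -
  define h where "h x = (sc x - sc m) / (\<Lambda> - sc m)" for x
  define f where "f x = (if x \<le> m then g x / Dr m else h x)" for x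
  have pos: "0 < \<Lambda> - sc m" "0 < d (Suc m)" using sc_less_\<Lambda>[OF sm, of m] d_pos by auto
  have le: "f y = g y / Dr m" if "y \<le> Suc m" for y
    using that g pos by (cases "y = Suc m") (auto simp: entry_def f_def h_def Dr_def sc_Suc)
  have ge: "f y = h y" if "y \<ge> m" for y
    using that g by (cases "y = m") (auto simp: entry_def f_def h_def)
  have "h \<longlonglongrightarrow> (\<Lambda> - sc m) / (\<Lambda> - sc m)"
    unfolding h_def[abs_def] using pos by (intro tendsto_intros sc_tendsto[OF sm]) auto
  then have "h \<longlonglongrightarrow> 1" using pos by simp
  moreover have "\<forall>\<^sub>F y in sequentially. h y = f y"
    using ge by (auto intro!: eventually_sequentiallyI[of m])
  ultimately have lim: "f \<longlonglongrightarrow> 1" by (rule Lim_transform_eventually)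
  have "avoid (insert m B) = f 0"
  proof (rule avoid_eq_harmonic[of m, OF _ _ _ _ _ lim])
    fix x assume "x \<in> insert m B"
    then show "f x = 0" using g B le[of x] by (auto simp: entry_def)
  next
    fix x assume x: "x \<notin> insert m B"
    show "harmonic_at f x"
    proof (cases "x < m")
      case True
      then have "harmonic_at g x" using g x by (simp add: entry_def)
      then have "harmonic_at (\<lambda>y. g y / Dr m) x"
        using harmonic_at_affine[of g x g "1 / Dr m" 0 0] by simp
      then show ?thesis
        by (subst harmonic_at_cong[where g = "\<lambda>y. g y / Dr m"]) (use True in \<open>auto intro!: le\<close>)
    next
      case False
      have "h = (\<lambda>x. 1 / (\<Lambda> - sc m) * sc x + 0 * sc x + - (sc m / (\<Lambda> - sc m)))"
        by (simp add: h_def fun_eq_iff diff_divide_distrib)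
      moreover have "harmonic_at sc x" using harmonic_at_sc False B by simp
      ultimately have "harmonic_at h x" by (simp only: harmonic_at_affine)
      then show ?thesis
        by (subst harmonic_at_cong[where g = h]) (use False x in \<open>auto intro!: ge\<close>)
    qed
  qed (use B in auto)
  then show ?thesis using le[of 0] by simp
qed

lemma avoid_singleton: "summable d \<Longrightarrow> n \<ge> 1 \<Longrightarrow> avoid {n} = e n 0 / Dr n"
  using avoid_insert[OF _ entry_empty] by simp

text \<open>Conditional probability that \<open>m\<close> is skipped given that \<open>n\<close> is:
  from \<open>n + 1\<close> the walk jumps over \<open>m\<close> (\<open>G n m\<close>) and then
  escapes (\<open>1 / Dr m\<close>), relative to the probability \<open>1 / Dr n\<close> of never
  returning to \<open>n\<close>.\<close>

definition \<rho> :: "nat \<Rightarrow> nat \<Rightarrow> real" where "\<rho> n m = G n m * Dr n / Dr m"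

text \<open>The skipped points form a Markov renewal process: given that \<open>n\<close> is skipped, the walk after
  its passage over \<open>n\<close> never returns, so it is independent of the skipped points below \<open>n\<close>.\<close>

lemma avoid_insert2:
  assumes sm: "summable d" and B: "B \<subseteq> {1..<n}" and n: "1 \<le> n" "n < m"
  shows "avoid (insert m (insert n B)) = \<rho> n m * avoid (insert n B)"
proof -
  have B': "B \<subseteq> {..<n}" "finite B" using B by (auto intro: finite_subset)
  then obtain g where g: "entry B n g" using entry_exists by blast
  have "avoid (insert m (insert n B)) = G n m * g 0 / Dr m"
    using avoid_insert[OF sm entry_insert[OF g n(2) B'(1)]] B n by force
  moreover have "avoid (insert n B) = g 0 / Dr n"
    using avoid_insert[OF sm g B n(1)] .
  ultimately show ?thesis
    using Dr_ge_1[OF sm, of n] by (simp add: \<rho>_def)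
qed

text \<open>Now \<open>sc\<close> is unbounded, so the glued function \<open>f\<close>, with
  \<open>f 0 \<le> 1\<close>, eventually exceeds every \<open>C\<close>; the test function
  \<open>f / C\<close> bounds the probability by \<open>1 / C\<close>.\<close>

lemma avoid_not_summable:
  assumes ns: "\<not> summable d" and n: "n \<ge> 1"
  shows "avoid {n} = 0"
proof -
  have *: "avoid {n} * C \<le> 1" if C: "C \<ge> 1" for C
  proof -
    define h where "h x = (sc x - sc n) / d (Suc n)" for x
    define f where "f x = (if x \<le> n then e n x else h x)" for x
    have le: "f y = e n y" if "y \<le> Suc n" for y
      using that d_pos[of "Suc n"] by (cases "y = Suc n") (auto simp: f_def e_Suc_self h_def sc_Suc)
    have ge: "f y = h y" if "y \<ge> n" for y
      using that by (cases "y = n") (auto simp: f_def e_self h_def)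
    obtain L where L: "\<forall>x\<ge>L. C * d (Suc n) + sc n \<le> sc x" using sc_unbounded[OF ns] by blast
    have "avoid {n} \<le> f 0 / C"
    proof (rule avoid_le_harmonic[of n _ _ "max L n"])
      fix x assume "x \<notin> {n}"
      have "harmonic_at f x"
      proof (cases "x < n")
        case True
        then show ?thesis
          using harmonic_at_cong[of f x "e n"] le[of "x - 1"] le[of x] le[of "x + 2"] harmonic_at_e by simp
      next
        case False
        have "h = (\<lambda>x. 1 / d (Suc n) * sc x + 0 * sc x + - (sc n / d (Suc n)))"
          by (simp add: h_def fun_eq_iff diff_divide_distrib)
        moreover have "harmonic_at sc x" using harmonic_at_sc False n by simp
        ultimately have "harmonic_at h x" by (simp only: harmonic_at_affine)
        then show ?thesis
          by (subst harmonic_at_cong[where g = h]) (use False \<open>x \<notin> {n}\<close> in \<open>auto intro!: ge\<close>)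
      qed
      then show "harmonic_at (\<lambda>x. f x / C) x"
        using harmonic_at_affine[of f x f "1 / C" 0 0] by simp
    next
      fix x
      have "0 \<le> f x"
        using e_nonneg[of x n] sc_mono[of n x] d_pos[of "Suc n"] by (auto simp: f_def h_def)
      then show "0 \<le> f x / C" using C by simp
    next
      fix x assume x: "max L n \<le> x"
      then have "C \<le> h x"
        using L d_pos[of "Suc n"] by (simp add: h_def pos_le_divide_eq le_diff_eq)
      then show "1 \<le> f x / C" using ge x C by simp
    qed (use n e_self in \<open>auto simp: f_def\<close>)
    moreover have "f 0 \<le> 1" using le[of 0] e_le_1[of 0 n] by simp
    ultimately show ?thesis using C by (simp add: pos_le_divide_eq)
  qed
  have nn: "0 \<le> avoid {n}" by (simp add: avoid_def)
  show ?thesis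
  proof (rule ccontr)
    assume "avoid {n} \<noteq> 0"
    with nn have pos: "0 < avoid {n}" by simp
    have "avoid {n} \<le> 1" by (simp add: avoid_def)
    then have "avoid {n} * (2 / avoid {n}) \<le> 1" using pos by (intro *) (simp add: pos_le_divide_eq)
    then show False using pos by simp
  qed
qed

end

section \<open>Growth of D\<close>

context drifted_walk
begin

lemma Dr_rec: "Dr n = 1 + U (Suc n) * Dr (Suc n)"
  using Dr_split[of n "Suc n"] d_Suc[of "Suc n"] d_pos[of "Suc n"] by (simp add: S_Suc_self)

text \<open>As \<open>1 + 3 * r n\<close> lies between 1 and 3, \<open>2 - a n\<close> lies between
  \<open>3 * r n\<close> and \<open>9 * r n\<close>; with the bounds on \<open>1 - U n\<close> this
  gives the constants here and in \<open>U_upper\<close>.\<close>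

lemma U_lower: "n \<ge> 1 \<Longrightarrow> 1 - 9/2 * r n \<le> U n"
proof -
  assume n: "n \<ge> 1"
  have "9 * r n / (1 + 3 * r n) \<le> 9 * r n / 1"
    using r_bounds[OF n] by (intro divide_left_mono) auto
  then have "2 - a n \<le> 9 * r n" unfolding two_minus_a[OF n] by simp
  then show ?thesis using one_minus_U_upper[OF n] by (simp add: field_simps)
qed

lemma U_upper: "n \<ge> 1 \<Longrightarrow> U n \<le> 1 - 3/4 * r n"
proof -
  assume n: "n \<ge> 1"
  have "9 * r n / 3 \<le> 9 * r n / (1 + 3 * r n)"
    using r_bounds[OF n] by (intro divide_left_mono) auto
  then have "3 * r n \<le> 2 - a n" unfolding two_minus_a[OF n] by simp
  then show ?thesis using one_minus_U_lower[OF n] by (simp add: field_simps)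
qed

text \<open>One step beyond \<open>n\<close> multiplies \<open>D\<close> by at most
  \<open>exp (9 * c / n)\<close>, hence at most \<open>n\<close> steps by
  \<open>exp (9 * c)\<close>.\<close>

lemma Dr_growth_polynomial:
  assumes sm: "summable d" and c: "c > 0" and r: "\<And>n. n \<ge> N \<Longrightarrow> r n \<le> c / real n"
  shows "\<exists>K>0. \<exists>N. \<forall>n\<ge>N. \<forall>j\<le>n. Dr (n + j) \<le> K * Dr n"
proof (intro exI conjI allI impI)
  show "exp (9 * c) > 0" by simp
  fix n j :: nat
  assume n: "max (max N 1) (nat \<lceil>9 * c\<rceil>) \<le> n" and j: "j \<le> n"
  have n1: "n \<ge> N" "n \<ge> 1" "9 * c \<le> real n" using n by linarith+
  \<comment> \<open>By \<open>U_lower\<close>, \<open>x\<close> bounds \<open>1 - U\<close> beyond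
    \<open>n\<close>; the threshold \<open>9 * c\<close> makes it at most 1/2, as used for
    \<open>exp (- (2 * x)) \<le> 1 - x\<close>.\<close>
  define x where "x = 9/2 * c / real n"
  have x: "0 < x" "x \<le> 1/2" using c n1 by (auto simp: x_def field_simps)
  have "exp (- (2 * x)) \<le> 1 - x"
  proof -
    have "1 \<le> (1 - x) * (1 + 2 * x)"
      using x mult_left_mono[of x "1/2" x] by (simp add: algebra_simps)
    also have "\<dots> \<le> (1 - x) * exp (2 * x)"
      using x exp_ge_add_one_self[of "2*x"] by (intro mult_left_mono) auto
    finally show ?thesis by (simp add: exp_minus field_simps)
  qed
  have step: "exp (- (2 * x)) * Dr (Suc m) \<le> Dr m" if m: "m \<ge> n" for m
  proof -
    have "r (Suc m) \<le> c / real (Suc m)" using r[of "Suc m"] n1 m by simp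
    also have "\<dots> \<le> c / real n" using c n1 m by (intro divide_left_mono) auto
    finally have "1 - x \<le> U (Suc m)" using U_lower[of "Suc m"] by (simp add: x_def)
    then have "exp (- (2 * x)) \<le> U (Suc m)" using \<open>exp (- (2 * x)) \<le> 1 - x\<close> by linarith
    then have "exp (- (2 * x)) * Dr (Suc m) \<le> U (Suc m) * Dr (Suc m)"
      using Dr_ge_1[OF sm, of "Suc m"] by (intro mult_right_mono) auto
    then show ?thesis using Dr_rec[of m] by linarith
  qed
  have "Dr (n + k) \<le> exp (2 * x * real k) * Dr n" for k
  proof (induction k)
    case (Suc k)
    have "Dr (n + Suc k) \<le> exp (2 * x) * Dr (n + k)"
      using step[of "n + k"] by (simp add: exp_minus field_simps)
    also have "\<dots> \<le> exp (2 * x) * (exp (2 * x * real k) * Dr n)"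
      using Suc by (intro mult_left_mono) auto
    also have "\<dots> = exp (2 * x + 2 * x * real k) * Dr n"
      by (simp only: exp_add mult.assoc)
    also have "2 * x + 2 * x * real k = 2 * x * real (Suc k)"
      by (simp add: algebra_simps)
    finally show ?case .
  qed simp
  also have "exp (2 * x * real j) * Dr n \<le> exp (9 * c) * Dr n"
  proof -
    have "2 * x * real j \<le> 2 * x * real n" using x j by simp
    also have "\<dots> = 9 * c" using n1 by (simp add: x_def)
    finally show ?thesis using Dr_ge_1[OF sm, of n] by (intro mult_right_mono) auto
  qed
  finally show "Dr (n + j) \<le> exp (9 * c) * Dr n" .
qed

text \<open>Comparison by backward induction from \<open>m\<close>, where \<open>S m m = 0\<close>:
  \<open>S\<close> solves the recursion of which \<open>W\<close> is a supersolution.\<close>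

lemma S_le_of_supersolution:
  assumes W: "\<And>n. n \<ge> N \<Longrightarrow> 0 \<le> W n" "\<And>n. n \<ge> N \<Longrightarrow> 1 + U (Suc n) * W (Suc n) \<le> W n"
    and n: "N \<le> n" "n \<le> m"
  shows "S n m \<le> W n"
  using n(2,1)
proof (induction n rule: inc_induct)
  case base
  then show ?case using W(1)[of m] by (simp add: S_def)
next
  case (step n)
  have "S n m = 1 + U (Suc n) * S (Suc n) m"
    using d_Suc[of "Suc n"] d_pos[of "Suc n"] d_pos[of "Suc (Suc n)"] U_pos[of "Suc n"]
    by (simp add: S_def sc_Suc field_simps)
  also have "\<dots> \<le> 1 + U (Suc n) * W (Suc n)"
    using step U_pos[of "Suc n"] by (intro add_left_mono mult_left_mono) auto
  finally show ?case using W(2)[of n] step by linarith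
qed

text \<open>If \<open>1 / r\<close> has small increments, then \<open>2 / r\<close> is a supersolution of the recursion for \<open>D\<close>,
  and \<open>D (n + 1) - D n = (1 - U (n + 1)) D (n + 1) - 1\<close> is bounded.\<close>

lemma Dr_growth_linear:
  assumes sm: "summable d" and N: "N \<ge> 1" and r: "\<And>n. n \<ge> N \<Longrightarrow> 0 < r n"
    and inc: "\<And>n. n \<ge> N \<Longrightarrow> 1 / r (Suc n) \<le> 1 / r n + 1/4"
  shows "\<exists>K>0. \<exists>N. \<forall>n\<ge>N. \<forall>j. Dr (n + j) \<le> Dr n + K * real j"
proof -
  \<comment> \<open>The drift gains \<open>3/4 * r\<close> times \<open>2 / r\<close>, that is 3/2;
    this pays for the summand 1 and for twice the increment 1/4 of \<open>1 / r\<close>.\<close>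
  have W: "1 + U (Suc n) * (2 / r (Suc n)) \<le> 2 / r n" if "n \<ge> N" for n
  proof -
    have "U (Suc n) * (2 / r (Suc n)) \<le> (1 - 3/4 * r (Suc n)) * (2 / r (Suc n))"
      using U_upper[of "Suc n"] r[of "Suc n"] that by (intro mult_right_mono) auto
    also have "\<dots> = 2 / r (Suc n) - 3/2" using r[of "Suc n"] that by (simp add: field_simps)
    finally show ?thesis using inc[OF that] by simp
  qed
  have Dr: "Dr n \<le> 2 / r n" if n: "n \<ge> N" for n
  proof -
    have "(\<lambda>m. S n m) \<longlonglongrightarrow> Dr n"
      unfolding S_def Dr_def using d_pos[of "Suc n"] by (intro tendsto_intros sc_tendsto[OF sm]) auto
    moreover have "\<forall>m\<ge>n. S n m \<le> 2 / r n"
      using S_le_of_supersolution[of N "\<lambda>n. 2 / r n", OF _ W n] r less_imp_le by auto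
    ultimately show ?thesis by (blast intro: LIMSEQ_le_const2)
  qed
  have step: "Dr (Suc n) \<le> Dr n + 9" if n: "n \<ge> N" for n
  proof -
    have "(1 - U (Suc n)) * Dr (Suc n) \<le> (9/2 * r (Suc n)) * (2 / r (Suc n))"
      using U_lower[of "Suc n"] U_le_1[of "Suc n"] Dr[of "Suc n"] Dr_ge_1[OF sm, of "Suc n"] n r[of "Suc n"]
      by (intro mult_mono) auto
    also have "\<dots> = 9" using r[of "Suc n"] n by simp
    finally show ?thesis using Dr_rec[of n] by (simp add: algebra_simps)
  qed
  have "Dr (n + j) \<le> Dr n + 9 * real j" if n: "n \<ge> N" for n j
  proof (induction j)
    case (Suc j)
    then show ?case using step[of "n + j"] n by simp
  qed simp
  then show ?thesis by (intro exI[of _ 9] conjI exI[of _ N]) auto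
qed

text \<open>The limit \<open>C\<close> governs the increments of \<open>1 / r\<close>. For
  \<open>C > 0\<close>, \<open>1 / r\<close> grows at least linearly, so \<open>r\<close> is of
  order at most \<open>1 / n\<close> and the multiplicative bound applies; it also applies if
  \<open>r\<close> reaches 0 and stays there. For \<open>C = 0\<close> the increments become small
  and the additive bound applies.\<close>

lemma Dr_growth:
  assumes sm: "summable d" and r0: "r \<longlonglongrightarrow> 0"
    and O: "O_lim (\<lambda>n. r n - r (n + 1)) (\<lambda>n. (r n)\<^sup>2)"
  obtains K N where "K > 0" "\<And>n j. N \<le> n \<Longrightarrow> j \<le> n \<Longrightarrow> Dr (n + j) \<le> K * (Dr n + real j)"
proof -
  note growth = that
  obtain C where C: "(\<lambda>n. (r n - r (n + 1)) / (r n)\<^sup>2) \<longlonglongrightarrow> C" using O by (auto simp: O_lim_def)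
  have poly: thesis if c: "c > 0" and r: "\<And>n. n \<ge> M \<Longrightarrow> r n \<le> c / real n" for c M
  proof -
    obtain K N where K: "K > 0" "\<forall>n\<ge>N. \<forall>j\<le>n. Dr (n + j) \<le> K * Dr n"
      using Dr_growth_polynomial[OF sm c, of M] r by auto
    show thesis
    proof (rule growth[OF K(1)])
      fix n j assume "N \<le> n" "j \<le> n"
      then have "Dr (n + j) \<le> K * Dr n" using K by blast
      also have "\<dots> \<le> K * (Dr n + real j)" using K by (intro mult_left_mono) auto
      finally show "Dr (n + j) \<le> K * (Dr n + real j)" .
    qed
  qed
  have C0: "0 \<le> C"
  proof (rule LIMSEQ_le_const[OF C], intro exI[of _ 1] allI impI)
    fix n :: nat assume "1 \<le> n"
    then show "0 \<le> (r n - r (n + 1)) / (r n)\<^sup>2" using r_Suc_le[of n] by simp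
  qed
  show thesis
  proof (cases "\<exists>n\<ge>1. r n = 0")
    case True
    then obtain M where M: "M \<ge> 1" "r M = 0" by blast
    have "r n \<le> 1 / real n" if "n \<ge> M" for n
      using r_antimono[OF M(1) that] M by simp (smt (verit) divide_nonneg_nonneg of_nat_0_le_iff)
    then show thesis by (rule poly[of 1 M, rotated]) auto
  next
    case False
    have rp: "0 < r n" if "n \<ge> 1" for n using False r_bounds[OF that] that by (metis less_le)
    show thesis
    proof (cases "C = 0")
      case True
      have "\<forall>\<^sub>F n in sequentially. (r n - r (n + 1)) / (r n)\<^sup>2 < 1/8"
        using order_tendstoD(2)[OF C, of "1/8"] True by simp
      then obtain N where N: "\<And>n. n \<ge> N \<Longrightarrow> (r n - r (n + 1)) / (r n)\<^sup>2 < 1/8"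
        unfolding eventually_sequentially by blast
      have inc: "1 / r (Suc n) \<le> 1 / r n + 1/4" if n: "n \<ge> max N 1" for n
      proof -
        have p: "0 < r n" "0 < r (Suc n)" "r n \<le> 1" using rp r_bounds[of n] n by auto
        \<comment> \<open>This also gives \<open>r (Suc n) \<ge> r n / 2\<close>, so the square is
          at most \<open>2 * (r n * r (Suc n))\<close>; dividing by the product yields the increment
          1/4.\<close>
        have *: "r n - r (Suc n) < 1/8 * (r n)\<^sup>2"
          using N[of n] n p by (simp add: pos_divide_less_eq)
        moreover have "(r n)\<^sup>2 \<le> r n" using p by (simp add: power2_eq_square mult_left_le)
        ultimately have half: "r n / 2 \<le> r (Suc n)" using p by linarith
        have "r n * (r n / 2) \<le> r n * r (Suc n)" using half p by (intro mult_left_mono) auto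
        then have "r n - r (Suc n) \<le> 1/4 * (r n * r (Suc n))"
          using * by (simp add: power2_eq_square)
        then show ?thesis using p by (simp add: field_simps)
      qed
      obtain K N' where K: "K > 0" "\<forall>n\<ge>N'. \<forall>j. Dr (n + j) \<le> Dr n + K * real j"
        using Dr_growth_linear[OF sm, of "max N 1"] rp inc by auto
      show thesis
      proof (rule growth[of "max K 1" N'])
        fix n j assume "N' \<le> n"
        then have "Dr (n + j) \<le> 1 * Dr n + K * real j" using K by simp
        also have "\<dots> \<le> max K 1 * Dr n + max K 1 * real j"
          using Dr_ge_1[OF sm, of n] by (intro add_mono mult_right_mono) auto
        finally show "Dr (n + j) \<le> max K 1 * (Dr n + real j)" by (simp add: distrib_left)
      qed simp
    next
      case False
      then have Cp: "C > 0" using C0 by simp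
      have "\<forall>\<^sub>F n in sequentially. C / 2 < (r n - r (n + 1)) / (r n)\<^sup>2"
        using order_tendstoD(1)[OF C, of "C/2"] Cp by simp
      then obtain N0 where N0: "\<And>n. n \<ge> N0 \<Longrightarrow> C / 2 < (r n - r (n + 1)) / (r n)\<^sup>2"
        unfolding eventually_sequentially by blast
      define N where "N = max N0 1"
      have inc: "1 / r n + C / 2 \<le> 1 / r (Suc n)" if n: "n \<ge> N" for n
      proof -
        have p: "0 < r n" "0 < r (Suc n)" "r (Suc n) \<le> r n"
          using rp r_Suc_le[of n] n N_def by auto
        have "C / 2 * (r n)\<^sup>2 < r n - r (Suc n)"
          using N0[of n] n p N_def by (simp add: pos_less_divide_eq)
        moreover have "C / 2 * (r n * r (Suc n)) \<le> C / 2 * (r n)\<^sup>2"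
          using p Cp by (simp add: power2_eq_square)
        ultimately have "C / 2 * (r n * r (Suc n)) \<le> r n - r (Suc n)" by linarith
        then show ?thesis using p by (simp add: field_simps)
      qed
      have lin: "C / 2 * real j \<le> 1 / r (N + j)" for j
      proof (induction j)
        case 0
        then show ?case using rp[of N] by (simp add: N_def less_imp_le)
      next
        case (Suc j)
        then show ?case using inc[of "N + j"] by (simp add: algebra_simps)
      qed
      \<comment> \<open>From \<open>2 * N\<close> on, \<open>n - N\<close> is at least half of
        \<open>n\<close>.\<close>
      have "r n \<le> (4 / C) / real n" if n: "n \<ge> 2 * N" for n
      proof -
        have p: "0 < r n" "0 < real n" using rp n N_def by auto
        have "C / 4 * real n \<le> C / 2 * real (n - N)" using n Cp by (simp add: of_nat_diff)
        also have "\<dots> \<le> 1 / r n" using lin[of "n - N"] n by simp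
        finally show ?thesis using p Cp by (simp add: field_simps)
      qed
      then show thesis using Cp by (intro poly[of "4 / C" "2 * N"]) auto
    qed
  qed
qed

end

section \<open>Finitely many skipped points\<close>

context skipping_chain
begin

definition ev :: "nat set \<Rightarrow> nat set \<Rightarrow> 'w set" where
  "ev I J = {\<omega> \<in> space M. (\<forall>i\<in>I. i \<in> skipped_points X \<omega>) \<and> (\<forall>j\<in>J. j \<notin> skipped_points X \<omega>)}"

lemma ev_events[measurable]: "ev I J \<in> events"
proof -
  have "\<And>i. {\<omega> \<in> space M. i \<in> I \<longrightarrow> i \<in> skipped_points X \<omega>} \<in> events"
    "\<And>i. {\<omega> \<in> space M. i \<in> J \<longrightarrow> i \<notin> skipped_points X \<omega>} \<in> events"
    by measurable
  then show ?thesis unfolding ev_def Ball_def by (auto intro!: sets.sets_Collect)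
qed

lemma prob_ev_empty: "prob (ev I {}) = avoid I"
  by (simp add: ev_def avoid_def)

lemma prob_ev_insert: "prob (ev I (insert j J)) = prob (ev I J) - prob (ev (insert j I) J)"
proof -
  have "ev I (insert j J) = ev I J - ev (insert j I) J" by (auto simp: ev_def)
  moreover have "ev (insert j I) J \<subseteq> ev I J" by (auto simp: ev_def)
  ultimately show ?thesis by (simp add: finite_measure_Diff)
qed

text \<open>Sites required to be visited are removed one at a time by complementation, which is
  linear in the probabilities and so preserves the identity of \<open>avoid_insert2\<close>.\<close>

lemma prob_ev_renewal:
  assumes sm: "summable d" and n: "1 \<le> n" "n < m" and I: "I \<subseteq> {1..<n}" and J: "J \<subseteq> {1..<n}"
  shows "prob (ev (insert m (insert n I)) J) = \<rho> n m * prob (ev (insert n I) J)"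
proof -
  have "finite J" using J finite_subset by auto
  then show ?thesis using I J
  proof (induction J arbitrary: I rule: finite_induct)
    case empty
    then show ?case using avoid_insert2[OF sm _ n] by (simp add: prob_ev_empty)
  next
    case (insert j J)
    then show ?case
      using insert.IH[of I] insert.IH[of "insert j I"]
      by (simp add: prob_ev_insert insert_commute[of j] right_diff_distrib)
  qed
qed

text \<open>Given the first skipped point \<open>n\<close> in \<open>{L<..2 * L}\<close>, the expected number of skipped points
  up to \<open>4 * L\<close> is at least \<open>\<kappa>\<close>.\<close>

lemma prob_block_le:
  assumes sm: "summable d" and L: "L \<ge> 1"
    and \<kappa>: "\<And>n. L < n \<Longrightarrow> n \<le> 2 * L \<Longrightarrow> \<kappa> \<le> (\<Sum>m\<in>R n. \<rho> n m)"
    and R: "\<And>n. L < n \<Longrightarrow> n \<le> 2 * L \<Longrightarrow> R n \<subseteq> {n<..4*L}"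
  shows "\<kappa> * \<P>(\<omega> in M. \<exists>n\<in>{L<..2*L}. n \<in> skipped_points X \<omega>) \<le> (\<Sum>m\<in>{L<..4*L}. avoid {m})"
proof -
  \<comment> \<open>The event that \<open>n\<close> is the first skipped point beyond
    \<open>L\<close>.\<close>
  let ?E = "\<lambda>n. ev {n} {L<..<n}"
  have sub: "{L<..<n} \<subseteq> {1..<n}" for n using L by auto
  have "{\<omega> \<in> space M. \<exists>n\<in>{L<..2*L}. n \<in> skipped_points X \<omega>} \<subseteq> (\<Union>n\<in>{L<..2*L}. ?E n)"
  proof clarsimp
    fix \<omega> n assume \<omega>: "\<omega> \<in> space M" "n \<in> skipped_points X \<omega>" and n: "L < n" "n \<le> 2 * L"
    define k where "k = (LEAST k. L < k \<and> k \<in> skipped_points X \<omega>)"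
    have "L < k \<and> k \<in> skipped_points X \<omega>"
      unfolding k_def by (rule LeastI[of _ n]) (use n \<omega> in auto)
    moreover have "k \<le> n" unfolding k_def by (rule Least_le) (use n \<omega> in auto)
    moreover have "j \<notin> skipped_points X \<omega>" if "L < j" "j < k" for j
      using not_less_Least[of j "\<lambda>k. L < k \<and> k \<in> skipped_points X \<omega>"] that by (auto simp: k_def)
    ultimately show "\<exists>x\<in>{L<..2*L}. \<omega> \<in> ?E x" using n \<omega> by (intro bexI[of _ k]) (auto simp: ev_def)
  qed
  then have "\<P>(\<omega> in M. \<exists>n\<in>{L<..2*L}. n \<in> skipped_points X \<omega>) \<le> prob (\<Union>n\<in>{L<..2*L}. ?E n)"
    by (intro finite_measure_mono) auto
  also have "\<dots> \<le> (\<Sum>n\<in>{L<..2*L}. prob (?E n))"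
    by (intro finite_measure_subadditive_finite) auto
  finally have "\<kappa> * \<P>(\<omega> in M. \<exists>n\<in>{L<..2*L}. n \<in> skipped_points X \<omega>)
      \<le> \<kappa> * (\<Sum>n\<in>{L<..2*L}. prob (?E n))" if "0 \<le> \<kappa>"
    using that by (rule mult_left_mono)
  moreover have "\<kappa> * \<P>(\<omega> in M. \<exists>n\<in>{L<..2*L}. n \<in> skipped_points X \<omega>) \<le> 0" if "\<kappa> < 0"
    using that by (simp add: mult_nonpos_nonneg)
  moreover have "0 \<le> (\<Sum>m\<in>{L<..4*L}. avoid {m})"
    by (intro sum_nonneg) (simp add: avoid_def)
  moreover have "\<kappa> * (\<Sum>n\<in>{L<..2*L}. prob (?E n)) \<le> (\<Sum>m\<in>{L<..4*L}. avoid {m})"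
  proof -
    have "\<kappa> * (\<Sum>n\<in>{L<..2*L}. prob (?E n))
        \<le> (\<Sum>n\<in>{L<..2*L}. \<Sum>m\<in>R n. prob (ev {m, n} {L<..<n}))"
      unfolding sum_distrib_left
    proof (intro sum_mono)
      fix n assume n: "n \<in> {L<..2*L}"
      have "\<kappa> * prob (?E n) \<le> (\<Sum>m\<in>R n. \<rho> n m) * prob (?E n)"
        using \<kappa>[of n] n by (intro mult_right_mono) auto
      also have "\<dots> = (\<Sum>m\<in>R n. prob (ev {m, n} {L<..<n}))"
        unfolding sum_distrib_right
        using prob_ev_renewal[OF sm _ _ _ sub, of n _ "{}"] R[of n] n L by (intro sum.cong) auto
      finally show "\<kappa> * prob (?E n) \<le> (\<Sum>m\<in>R n. prob (ev {m, n} {L<..<n}))" .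
    qed
    also have "\<dots> \<le> (\<Sum>n\<in>{L<..2*L}. \<Sum>m\<in>{L<..4*L}. if n < m then prob (ev {m, n} {L<..<n}) else 0)"
    proof (intro sum_mono)
      fix n assume n: "n \<in> {L<..2*L}"
      have "(\<Sum>m\<in>R n. prob (ev {m, n} {L<..<n}))
          = (\<Sum>m\<in>R n. if n < m then prob (ev {m, n} {L<..<n}) else 0)"
        using R[of n] n by (intro sum.cong) auto
      also have "\<dots> \<le> (\<Sum>m\<in>{L<..4*L}. if n < m then prob (ev {m, n} {L<..<n}) else 0)"
        using R[of n] n by (intro sum_mono2) fastforce+
      finally show "(\<Sum>m\<in>R n. prob (ev {m, n} {L<..<n}))
          \<le> (\<Sum>m\<in>{L<..4*L}. if n < m then prob (ev {m, n} {L<..<n}) else 0)" .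
    qed
    also have "\<dots> = (\<Sum>m\<in>{L<..4*L}. \<Sum>n\<in>{L<..2*L}. if n < m then prob (ev {m, n} {L<..<n}) else 0)"
      by (rule sum.swap)
    \<comment> \<open>For fixed \<open>m\<close> these events are disjoint, as the first skipped
      point beyond \<open>L\<close> is unique, and all imply that \<open>m\<close> is
      skipped.\<close>
    also have "\<dots> \<le> (\<Sum>m\<in>{L<..4*L}. avoid {m})"
    proof (intro sum_mono)
      fix m
      have "(\<Sum>n\<in>{L<..2*L}. if n < m then prob (ev {m, n} {L<..<n}) else 0)
          = (\<Sum>n\<in>{L<..2*L} \<inter> {..<m}. prob (ev {m, n} {L<..<n}))"
        by (simp add: sum.inter_restrict)
      also have "\<dots> = prob (\<Union>n\<in>{L<..2*L} \<inter> {..<m}. ev {m, n} {L<..<n})"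
      proof (intro finite_measure_finite_Union[symmetric])
        have "ev {m, n} {L<..<n} \<inter> ev {m, n'} {L<..<n'} = {}" if "n < n'" "L < n" for n n'
          using that by (auto simp: ev_def)
        then show "disjoint_family_on (\<lambda>n. ev {m, n} {L<..<n}) ({L<..2*L} \<inter> {..<m})"
          unfolding disjoint_family_on_def
          by (metis Int_commute Int_iff greaterThanAtMost_iff linorder_neqE_nat)
      qed auto
      also have "\<dots> \<le> prob (ev {m} {})"
        by (intro finite_measure_mono) (auto simp: ev_def)
      finally show "(\<Sum>n\<in>{L<..2*L}. if n < m then prob (ev {m, n} {L<..<n}) else 0) \<le> avoid {m}"
        by (simp add: prob_ev_empty)
    qed
    finally show ?thesis .
  qed
  ultimately show ?thesis by linarith
qed

text \<open>\<open>S n (n + j)\<close> is at most \<open>D n\<close> and at most \<open>j\<close>.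
  Using one bound against each summand of \<open>D n + j\<close> gives
  \<open>S n (n + j) * D (n + j) \<le> 2 * K * j * D n\<close>; the constant is 108 = 2 *
  54.\<close>

lemma \<rho>_ge:
  assumes sm: "summable d" and n: "n \<ge> 3" and j: "j \<ge> 1" "even j" and K: "K > 0"
    and growth: "Dr (n + j) \<le> K * (Dr n + real j)"
  shows "a 1 / (108 * K) / real j \<le> \<rho> n (n + j)"
proof -
  define Dn Dm s t where "Dn = Dr n" and "Dm = Dr (n + j)" and "s = S n (n + j)" and "t = real j"
  have pos: "1 \<le> Dn" "1 \<le> Dm" "1 \<le> s" "1 \<le> t" "0 < a 1"
    using Dr_ge_1[OF sm] S_ge_1[of n "n + j"] j a_pos[of 1] by (auto simp: Dn_def Dm_def s_def t_def)
  have s: "s \<le> Dn" "s \<le> t"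
    using S_le_Dr[OF sm] S_le[of n j] by (auto simp: Dn_def s_def t_def)
  have "s * Dm \<le> s * (K * (Dn + t))"
    using growth pos by (intro mult_left_mono) (auto simp: Dn_def Dm_def t_def)
  also have "\<dots> = K * (s * Dn + s * t)" by (simp add: algebra_simps)
  also have "\<dots> \<le> K * (t * Dn + Dn * t)"
    using s pos K by (intro mult_left_mono add_mono mult_right_mono) auto
  finally have *: "s * Dm \<le> 2 * K * t * Dn" by (simp add: algebra_simps)
  have "a 1 / (108 * K) / t = a 1 / 54 * (Dn / (2 * K * t * Dn))"
    using pos K by simp
  also have "\<dots> \<le> a 1 / 54 * (Dn / (s * Dm))"
    using pos K * by (intro mult_left_mono divide_left_mono) auto
  also have "\<dots> = a 1 / 54 / s * (Dn / Dm)" by simp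
  also have "\<dots> \<le> G n (n + j) * (Dn / Dm)"
    using G_lower[of n "n + j"] n j pos by (intro mult_right_mono) (auto simp: s_def)
  finally show ?thesis by (simp add: \<rho>_def Dn_def Dm_def t_def)
qed

lemma avoid_le: "summable d \<Longrightarrow> n \<ge> 1 \<Longrightarrow> avoid {n} \<le> 1 / Dr n"
  using avoid_singleton[of n] e_le_1[of 0 n] Dr_ge_1[of n] by (simp add: divide_right_mono)

text \<open>Summing the lower bound of order \<open>1 / j\<close> for \<open>\<rho>\<close> gives a
  harmonic sum, so \<open>\<kappa>\<close> is of order \<open>k\<close>, that is of order
  \<open>ln m\<close> on the block. Dividing by \<open>\<kappa>\<close> produces the weight
  \<open>1 / ln m\<close>.\<close>

lemma prob_dyadic_block_le:
  assumes sm: "summable d" and K: "K > 0"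
    and growth: "\<And>n j. N \<le> n \<Longrightarrow> j \<le> n \<Longrightarrow> Dr (n + j) \<le> K * (Dr n + real j)"
    and k: "k \<ge> 2" "N \<le> 2 ^ k"
  shows "\<P>(\<omega> in M. \<exists>n\<in>{2^k<..2^Suc k}. n \<in> skipped_points X \<omega>)
    \<le> 864 * K / a 1 * (\<Sum>m\<in>{2^k<..2^(k+2)}. 1 / (Dr m * ln (real m)))"
proof -
  define L where "L = (2::nat) ^ k"
  define \<pi> where "\<pi> = \<P>(\<omega> in M. \<exists>n\<in>{L<..2*L}. n \<in> skipped_points X \<omega>)"
  define H where "H = (2::nat) ^ (k - 1)"
  obtain i where i: "k = Suc i" using k by (cases k) auto
  have L: "L = 2 * H" "H \<ge> 1" "2 ^ Suc k = 2 * L" "2 ^ (k + 2) = 4 * L" "L \<ge> 4"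
    using k power_increasing[of 2 k "2::nat"]
    by (auto simp: L_def H_def i)
  have A: "0 < a 1" using a_pos[of 1] by simp
  define \<kappa> where "\<kappa> = a 1 / (216 * K) * (real (k - 1) * ln 2)"
  have "\<kappa> * \<pi> \<le> (\<Sum>m\<in>{L<..4*L}. avoid {m})"
    unfolding \<pi>_def
  \<comment> \<open>The offsets are even, as \<open>\<rho>_ge\<close> demands, and at most
    \<open>2 * H = L < n\<close>, so that the growth bound applies.\<close>
  proof (rule prob_block_le[OF sm, of L \<kappa> "\<lambda>n. (\<lambda>i. n + 2 * i) ` {1..H}"])
    fix n assume n: "L < n" "n \<le> 2 * L"
    have "ln (real H) \<le> ln (real H + 1)" using L by simp
    also have "\<dots> \<le> harm H" by (rule ln_le_harm)
    finally have "real (k - 1) * ln 2 \<le> harm H" by (simp add: H_def ln_realpow)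
    then have "\<kappa> \<le> a 1 / (216 * K) * harm H"
      unfolding \<kappa>_def using A K by (intro mult_left_mono) auto
    also have "\<dots> = (\<Sum>i\<in>{1..H}. a 1 / (108 * K) / real (2 * i))"
      unfolding harm_def sum_distrib_left by (intro sum.cong) (auto simp: field_simps)
    also have "\<dots> \<le> (\<Sum>i\<in>{1..H}. \<rho> n (n + 2 * i))"
    proof (intro sum_mono)
      fix i assume i: "i \<in> {1..H}"
      show "a 1 / (108 * K) / real (2 * i) \<le> \<rho> n (n + 2 * i)"
        using i n L k growth[of n "2 * i"] by (intro \<rho>_ge[OF sm _ _ _ K]) (auto simp: L_def[symmetric])
    qed
    also have "\<dots> = (\<Sum>m\<in>(\<lambda>i. n + 2 * i) ` {1..H}. \<rho> n m)"
      by (subst sum.reindex) (auto simp: inj_on_def)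
    finally show "\<kappa> \<le> (\<Sum>m\<in>(\<lambda>i. n + 2 * i) ` {1..H}. \<rho> n m)" .
    show "(\<lambda>i. n + 2 * i) ` {1..H} \<subseteq> {n<..4*L}" using n L by auto
  qed (use L in auto)
  also have "\<dots> \<le> (\<Sum>m\<in>{L<..4*L}. (4 * (real (k - 1) * ln 2)) * (1 / (Dr m * ln (real m))))"
  proof (intro sum_mono)
    fix m assume m: "m \<in> {L<..4*L}"
    have "m \<le> 2 ^ (k + 2)" using m unfolding L(4) by simp
    then have "real m \<le> real (2 ^ (k + 2))" by (rule of_nat_mono)
    then have "ln (real m) \<le> ln (2 ^ (k + 2))" using m by (intro ln_mono) auto
    also have "\<dots> = real (k + 2) * ln 2" by (subst ln_realpow) auto
    \<comment> \<open>\<open>k + 2 \<le> 4 * (k - 1)\<close> because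
      \<open>k \<ge> 2\<close>.\<close>
    also have "\<dots> \<le> (4 * real (k - 1)) * ln 2"
      using k by (intro mult_right_mono) (auto simp: of_nat_diff)
    finally have one: "1 \<le> (4 * (real (k - 1) * ln 2)) / ln (real m)"
      using m L by (subst pos_le_divide_eq) auto
    have "1 / Dr m * 1 \<le> 1 / Dr m * ((4 * (real (k - 1) * ln 2)) / ln (real m))"
      by (rule mult_left_mono[OF one]) (use Dr_ge_1[OF sm, of m] in simp)
    then show "avoid {m} \<le> (4 * (real (k - 1) * ln 2)) * (1 / (Dr m * ln (real m)))"
      using avoid_le[OF sm, of m] m by simp
  qed
  also have "\<dots> = \<kappa> * (864 * K / a 1 * (\<Sum>m\<in>{L<..4*L}. 1 / (Dr m * ln (real m))))"
    unfolding sum_distrib_left[symmetric] using A K by (simp add: \<kappa>_def)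
  finally have "\<kappa> * \<pi> \<le> \<kappa> * (864 * K / a 1 * (\<Sum>m\<in>{L<..4*L}. 1 / (Dr m * ln (real m))))" .
  moreover have "0 < \<kappa>" using A K k by (simp add: \<kappa>_def)
  ultimately have "\<pi> \<le> 864 * K / a 1 * (\<Sum>m\<in>{L<..4*L}. 1 / (Dr m * ln (real m)))"
    by (simp only: mult_le_cancel_left_pos)
  then show ?thesis by (simp only: \<pi>_def L(3,4) L_def[symmetric])
qed

section \<open>Almost sure finiteness in the recurrent and the transient case\<close>

lemma AE_finite_of_no_skips_beyond:
  assumes "AE \<omega> in M. \<exists>N. \<forall>n>N. n \<notin> skipped_points X \<omega>"
  shows "AE \<omega> in M. finite (skipped_points X \<omega>)"
  using assms
proof eventually_elim
  case (elim \<omega>)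
  then obtain N where "\<forall>n>N. n \<notin> skipped_points X \<omega>" by blast
  then have "skipped_points X \<omega> \<subseteq> {..N}" by (auto simp: not_less[symmetric])
  then show ?case by (rule finite_subset) simp
qed

lemma finitely_many_skipped_recurrent:
  assumes "\<not> summable d"
  shows "AE \<omega> in M. finite (skipped_points X \<omega>)"
proof (rule AE_finite_of_no_skips_beyond)
  have "AE \<omega> in M. n \<notin> skipped_points X \<omega>" if "n > 0" for n
  proof -
    have "\<P>(\<omega> in M. n \<in> skipped_points X \<omega>) = 0"
      using avoid_not_summable[OF assms, of n] that by (simp add: avoid_def)
    then show ?thesis by (subst (asm) prob_eq_0) auto
  qed
  then have "AE \<omega> in M. \<forall>n. n > 0 \<longrightarrow> n \<notin> skipped_points X \<omega>"
    unfolding AE_all_countable by (auto intro: AE_impI)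
  then show "AE \<omega> in M. \<exists>N. \<forall>n>N. n \<notin> skipped_points X \<omega>" by eventually_elim blast
qed

lemma finitely_many_skipped_transient:
  assumes sm: "summable d" and r0: "r \<longlonglongrightarrow> 0"
    and O: "O_lim (\<lambda>n. r n - r (n + 1)) (\<lambda>n. (r n)\<^sup>2)"
    and sum: "summable (\<lambda>n. 1 / (Dr n * ln (real n)))"
  shows "AE \<omega> in M. finite (skipped_points X \<omega>)"
proof -
  obtain K N where K: "K > 0" "\<And>n j. N \<le> n \<Longrightarrow> j \<le> n \<Longrightarrow> Dr (n + j) \<le> K * (Dr n + real j)"
    using Dr_growth[OF sm r0 O] by blast
  define f where "f n = 1 / (Dr n * ln (real n))" for n
  have f0: "0 \<le> f n" for n using Dr_ge_1[OF sm, of n] by (cases "n = 0") (auto simp: f_def)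
  define h where "h k = (\<Sum>m\<in>{2^k<..2^Suc k}. f m)" for k :: nat
  have "summable h"
  proof (rule bounded_imp_summable)
    show "0 \<le> h k" for k unfolding h_def using f0 by (intro sum_nonneg) auto
    fix k
    have "(\<Sum>i\<le>k. h i) = sum f {1<..2^Suc k}"
    proof (induction k)
      case 0
      then show ?case by (simp add: h_def)
    next
      case (Suc k)
      have "sum f {1<..2^Suc k} + sum f {2^Suc k<..2^Suc (Suc k)} = sum f ({1<..2^Suc k} \<union> {2^Suc k<..2^Suc (Suc k)})"
        by (intro sum.union_disjoint[symmetric]) auto
      also have "{1<..2^Suc k} \<union> {2^Suc k<..2^Suc (Suc k)} = {1<..(2::nat)^Suc (Suc k)}"
        by (intro ivl_disj_un) auto
      finally show ?case using Suc by (simp add: h_def)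
    qed
    also have "\<dots> \<le> suminf f"
      using sum f0 by (intro sum_le_suminf) (auto simp: f_def[abs_def])
    finally show "(\<Sum>i\<le>k. h i) \<le> suminf f" .
  qed
  define A where "A k = {\<omega> \<in> space M. \<exists>n\<in>{2^k<..2^Suc k}. n \<in> skipped_points X \<omega>}" for k :: nat
  have A_ev: "A k \<in> events" for k unfolding A_def by measurable
  have "summable (\<lambda>k. prob (A k))"
  proof (rule summable_comparison_test')
    have "summable (\<lambda>k. h k + h (Suc k))"
      using \<open>summable h\<close> summable_Suc_iff[of h] by (intro summable_add) auto
    then show "summable (\<lambda>k. 864 * K / a 1 * (h k + h (Suc k)))" by (rule summable_mult)
    fix k assume k: "max 2 N \<le> k"
    then have "N \<le> 2 ^ k" using less_exp[of k] by linarith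
    then have "prob (A k) \<le> 864 * K / a 1 * (\<Sum>m\<in>{2^k<..2^(k+2)}. f m)"
      unfolding A_def f_def using prob_dyadic_block_le[OF sm K, of k] k by simp
    \<comment> \<open>The estimate for one block involves two consecutive dyadic blocks of the
      series.\<close>
    also have "(\<Sum>m\<in>{2^k<..2^(k+2)}. f m) = h k + h (Suc k)"
    proof -
      have "h k + h (Suc k) = sum f ({2^k<..2^Suc k} \<union> {2^Suc k<..2^(k+2)})"
        unfolding h_def by (subst sum.union_disjoint) auto
      also have "{2^k<..2^Suc k} \<union> {2^Suc k<..2^(k+2)} = {(2::nat)^k<..2^(k+2)}"
        by (intro ivl_disj_un) auto
      finally show ?thesis by simp
    qed
    finally show "norm (prob (A k)) \<le> 864 * K / a 1 * (h k + h (Suc k))" by simp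
  qed
  then have "AE \<omega> in M. \<forall>\<^sub>F k in sequentially. \<omega> \<in> space M - A k"
    using A_ev by (intro borel_cantelli_AE1) (auto simp: emeasure_eq_measure)
  then have "AE \<omega> in M. \<exists>N. \<forall>n>N. n \<notin> skipped_points X \<omega>"
  proof eventually_elim
    case (elim \<omega>)
    then obtain k0 where k0: "\<And>k. k \<ge> k0 \<Longrightarrow> \<omega> \<in> space M - A k"
      unfolding eventually_sequentially by blast
    show ?case
    proof (intro exI[of _ "2 ^ Suc k0"] allI impI notI)
      fix n :: nat assume n: "2 ^ Suc k0 < n" "n \<in> skipped_points X \<omega>"
      have "(2::nat) \<le> 2 ^ Suc k0" by simp
      then have "2 \<le> n" using n(1) by linarith
      then obtain k where k: "2 ^ k < n" "n \<le> 2 ^ (k + 1)"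
        using ex_power_ivl2[of 2 n] by auto
      have "k0 \<le> k" using less_le_trans[OF n(1) k(2)] by simp
      then show False using k0[of k] k n by (auto simp: A_def)
    qed
  qed
  then show ?thesis by (rule AE_finite_of_no_skips_beyond)
qed

end

section \<open>Infinitely many skipped points\<close>

lemma sum_sum_symmetric:
  fixes F :: "nat \<Rightarrow> nat \<Rightarrow> real"
  assumes sym: "\<And>i j. F i j = F j i" and N: "k \<le> N"
  shows "(\<Sum>i\<in>{k..<N}. \<Sum>j\<in>{k..<N}. F i j) = (\<Sum>i\<in>{k..<N}. F i i + 2 * (\<Sum>j\<in>{Suc i..<N}. F i j))"
  using N
proof (induction N rule: dec_induct)
  case (step N)
  have "(\<Sum>i\<in>{k..<N}. F i N) = (\<Sum>i\<in>{k..<N}. F N i)"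
    by (intro sum.cong refl sym)
  then have "(\<Sum>i\<in>{k..<Suc N}. \<Sum>j\<in>{k..<Suc N}. F i j)
      = (\<Sum>i\<in>{k..<N}. \<Sum>j\<in>{k..<N}. F i j) + 2 * (\<Sum>i\<in>{k..<N}. F i N) + F N N"
    using step(1) by (simp add: sum.distrib)
  also have "\<dots> = (\<Sum>i\<in>{k..<N}. F i i + 2 * (\<Sum>j\<in>{Suc i..<Suc N}. F i j)) + F N N"
  proof -
    have "(\<Sum>i\<in>{k..<N}. F i i + 2 * (\<Sum>j\<in>{Suc i..<Suc N}. F i j))
        = (\<Sum>i\<in>{k..<N}. F i i + 2 * (\<Sum>j\<in>{Suc i..<N}. F i j) + 2 * F i N)"
      by (intro sum.cong) auto
    then show ?thesis using step by (simp add: sum.distrib sum_distrib_left)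
  qed
  also have "\<dots> = (\<Sum>i\<in>{k..<Suc N}. F i i + 2 * (\<Sum>j\<in>{Suc i..<Suc N}. F i j))"
    using step(1) by simp
  finally show ?case .
qed simp

text \<open>Chebyshev's inequality at distance \<open>\<mu> / 2\<close> from the mean, with the
  variance expanded into covariances.\<close>

lemma (in prob_space) weighted_second_moment:
  fixes A :: "nat \<Rightarrow> 'a set" and c :: "nat \<Rightarrow> real"
  assumes I: "finite I" and A[measurable]: "\<And>i. A i \<in> events"
    and \<mu>: "\<mu> = (\<Sum>i\<in>I. c i * prob (A i))" "\<mu> > 0"
    and v: "(\<Sum>i\<in>I. \<Sum>j\<in>I. c i * c j * (prob (A i \<inter> A j) - prob (A i) * prob (A j))) \<le> v"
  shows "\<P>(\<omega> in M. (\<Sum>i\<in>I. c i * indicator (A i) \<omega>) \<le> \<mu> / 2) \<le> 4 * v / \<mu>\<^sup>2"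
proof -
  define Z where "Z \<omega> = (\<Sum>i\<in>I. c i * indicator (A i) \<omega>)" for \<omega>
  have Z[measurable]: "random_variable borel Z" unfolding Z_def[abs_def] by measurable
  have Z2: "(Z \<omega>)\<^sup>2 = (\<Sum>i\<in>I. \<Sum>j\<in>I. c i * c j * indicator (A i \<inter> A j) \<omega>)" for \<omega>
    unfolding Z_def power2_eq_square sum_product
    by (intro sum.cong refl) (simp add: indicator_inter_arith)
  have int_ind: "integrable M (\<lambda>\<omega>. indicator B \<omega> :: real)" if "B \<in> events" for B
    using that by (simp add: emeasure_eq_measure)
  have int: "integrable M Z" "integrable M (\<lambda>\<omega>. (Z \<omega>)\<^sup>2)"
    unfolding Z2 by (auto simp: Z_def[abs_def] intro!: Bochner_Integration.integrable_sum int_ind)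
  have EZ: "expectation Z = \<mu>"
    unfolding Z_def[abs_def] \<mu>(1)
    by (subst Bochner_Integration.integral_sum) (auto intro!: int_ind)
  have "expectation (\<lambda>\<omega>. (Z \<omega>)\<^sup>2) = (\<Sum>i\<in>I. \<Sum>j\<in>I. c i * c j * prob (A i \<inter> A j))"
    unfolding Z2
    by (subst Bochner_Integration.integral_sum, intro Bochner_Integration.integrable_sum,
        (auto intro!: int_ind)[1], intro sum.cong refl, subst Bochner_Integration.integral_sum)
      (auto intro!: int_ind)
  moreover have "\<mu>\<^sup>2 = (\<Sum>i\<in>I. \<Sum>j\<in>I. c i * c j * (prob (A i) * prob (A j)))"
    unfolding \<mu>(1) power2_eq_square sum_product by (intro sum.cong refl) (simp add: algebra_simps)
  ultimately have "expectation (\<lambda>\<omega>. (Z \<omega>)\<^sup>2) - \<mu>\<^sup>2 \<le> v"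
    using v by (simp add: right_diff_distrib sum_subtractf)
  then have "variance Z \<le> v"
    using variance_eq[OF int] EZ by simp
  then have "variance Z / (\<mu> / 2)\<^sup>2 \<le> 4 * v / \<mu>\<^sup>2"
    by (simp add: power_divide divide_right_mono)
  moreover have "prob {\<omega> \<in> space M. \<bar>Z \<omega> - \<mu>\<bar> \<ge> \<mu> / 2} \<le> variance Z / (\<mu> / 2)\<^sup>2"
    using Chebyshev_inequality[OF Z int(2), of "\<mu> / 2"] \<mu>(2) by (simp add: EZ)
  moreover have "\<mu> / 2 \<le> \<bar>Z \<omega> - \<mu>\<bar>" if "Z \<omega> \<le> \<mu> / 2" for \<omega>
    using that abs_ge_minus_self[of "Z \<omega> - \<mu>"] by linarith
  then have "\<P>(\<omega> in M. Z \<omega> \<le> \<mu> / 2) \<le> prob {\<omega> \<in> space M. \<bar>Z \<omega> - \<mu>\<bar> \<ge> \<mu> / 2}"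
    by (intro finite_measure_mono) auto
  ultimately show ?thesis unfolding Z_def by linarith
qed

context drifted_walk
begin

abbreviation \<theta> :: real where "\<theta> \<equiv> 1 / (1 + a 1 / 3)"

lemma \<theta>_bounds: "0 < \<theta>" "\<theta> < 1"
  using a_pos[of 1] by auto

text \<open>Each summand is a relative increment \<open>x\<close> of \<open>S n\<close>, at most 1,
  so \<open>x \<le> 2 * ln (1 + x)\<close>; the logarithms telescope from
  \<open>S n (Suc n) = 1\<close>.\<close>

lemma sum_increments_S_le:
  assumes sm: "summable d" and N: "Suc n \<le> N"
  shows "(\<Sum>m\<in>{Suc n..<N}. d (Suc m) / d (Suc n) / S n m) \<le> 2 * ln (Dr n)"
proof -
  have "(\<Sum>m\<in>{Suc n..<N}. d (Suc m) / d (Suc n) / S n m)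
      \<le> (\<Sum>m\<in>{Suc n..<N}. 2 * ln (S n (Suc m)) - 2 * ln (S n m))"
  proof (intro sum_mono)
    fix m assume m: "m \<in> {Suc n..<N}"
    define x where "x = d (Suc m) / d (Suc n) / S n m"
    have S: "1 \<le> S n m" using S_ge_1 m by simp
    have "d (Suc m) / d (Suc n) \<le> 1"
      using d_antimono[of "Suc n" "Suc m"] d_pos[of "Suc n"] m by simp
    then have "x \<le> 1 / 1"
      unfolding x_def using S d_pos[of "Suc m"] d_pos[of "Suc n"] by (intro frac_le) auto
    then have x: "0 < x" "x \<le> 1"
      using S d_pos[of "Suc m"] d_pos[of "Suc n"] by (auto simp: x_def)
    have "ln (1 / (1 + x)) \<le> 1 / (1 + x) - 1" using x by (intro ln_le_minus_one) simp
    then have "x / (1 + x) \<le> ln (1 + x)" using x by (simp add: ln_div field_simps)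
    moreover have "x / 2 \<le> x / (1 + x)" using x by (intro divide_left_mono) auto
    ultimately have "x \<le> 2 * ln (1 + x)" by linarith
    also have "1 + x = S n (Suc m) / S n m"
      using S by (simp add: x_def S_Suc add_divide_distrib)
    also have "ln (S n (Suc m) / S n m) = ln (S n (Suc m)) - ln (S n m)"
      using S S_ge_1[of n "Suc m"] m by (simp add: ln_div)
    finally show "x \<le> 2 * ln (S n (Suc m)) - 2 * ln (S n m)" by simp
  qed
  also have "\<dots> = 2 * ln (S n N) - 2 * ln (S n (Suc n))"
    using sum_Suc_diff'[OF N, of "\<lambda>m. 2 * ln (S n m)"] .
  also have "\<dots> \<le> 2 * ln (Dr n)"
    using S_le_Dr[OF sm, of n N] S_ge_1[of n N] N by (simp add: S_Suc_self)
  finally show ?thesis .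
qed

lemma sum_geometric_le:
  "(\<Sum>m\<in>{Suc n..<N}. 2 * \<theta> ^ (m - n) * (1 + real (m - n))) \<le> 2 / (1 - \<theta>)\<^sup>2"
proof -
  have sums: "(\<lambda>j. real (Suc j) * \<theta> ^ j) sums (1 / (1 - \<theta>)\<^sup>2)"
    using geometric_deriv_sums[of \<theta>] \<theta>_bounds by simp
  have "(\<Sum>m\<in>{Suc n..<N}. real (Suc (m - n)) * \<theta> ^ (m - n))
      = (\<Sum>j\<in>(\<lambda>m. m - n) ` {Suc n..<N}. real (Suc j) * \<theta> ^ j)"
    by (subst sum.reindex) (auto simp: inj_on_def)
  also have "\<dots> \<le> (\<Sum>j. real (Suc j) * \<theta> ^ j)"
    using sums \<theta>_bounds by (intro sum_le_suminf) (auto simp: sums_iff)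
  also have "\<dots> = 1 / (1 - \<theta>)\<^sup>2" using sums by (simp add: sums_iff)
  finally have "(\<Sum>m\<in>{Suc n..<N}. real (Suc (m - n)) * \<theta> ^ (m - n)) \<le> 1 / (1 - \<theta>)\<^sup>2" .
  moreover have "(\<Sum>m\<in>{Suc n..<N}. 2 * \<theta> ^ (m - n) * (1 + real (m - n)))
      = 2 * (\<Sum>m\<in>{Suc n..<N}. real (Suc (m - n)) * \<theta> ^ (m - n))"
    unfolding sum_distrib_left by (intro sum.cong) (auto simp: algebra_simps)
  ultimately show ?thesis by simp
qed

end

context skipping_chain
begin

text \<open>Writing \<open>D n = S + \<pi> D m\<close>, the main term \<open>D n / (S D m)\<close> of \<open>\<rho> n m\<close> equals
  \<open>1 / D m + \<pi> / S\<close>, and its first summand cancels against \<open>avoid {m}\<close>.\<close>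

lemma covariance_le:
  assumes sm: "summable d" and n: "1 \<le> n" "n < m"
  shows "avoid {n, m} - avoid {n} * avoid {m}
    \<le> avoid {n} * (d (Suc m) / d (Suc n) / S n m + 2 * \<theta> ^ (m - n) * (1 + real (m - n)))"
proof -
  define \<pi> where "\<pi> = d (Suc m) / d (Suc n)"
  have pos: "1 \<le> S n m" "1 \<le> Dr n" "1 \<le> Dr m" "0 < \<pi>"
    using S_ge_1[OF n(2)] Dr_ge_1[OF sm] d_pos by (auto simp: \<pi>_def)
  have e: "0 \<le> e m 0" "e m 0 \<le> 1" using e_nonneg[of 0 m] e_le_1[of 0 m] by auto
  have split: "Dr n = S n m + \<pi> * Dr m" using Dr_split[of n m] by (simp add: \<pi>_def)
  \<comment> \<open>This linear bound on \<open>Dr n / Dr m\<close> is used in the error term, where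
    the geometric factor absorbs it.\<close>
  have "Dr n \<le> real (m - n) + Dr m" using Dr_le_add[OF sm, of n "m - n"] n by simp
  also have "\<dots> \<le> (1 + real (m - n)) * Dr m"
    using pos mult_left_mono[of 1 "Dr m" "real (m - n)"] by (simp add: distrib_right)
  finally have ratio: "Dr n / Dr m \<le> 1 + real (m - n)" using pos by (simp add: pos_divide_le_eq)
  have "\<rho> n m = G n m * (Dr n / Dr m)" by (simp add: \<rho>_def)
  also have "\<dots> \<le> (e m 0 / S n m + 2 * \<theta> ^ (m - n)) * (Dr n / Dr m)"
    using G_upper[OF n] pos by (intro mult_right_mono) auto
  also have "\<dots> = e m 0 / S n m * (Dr n / Dr m) + 2 * \<theta> ^ (m - n) * (Dr n / Dr m)"
    by (rule distrib_right)
  also have "\<dots> \<le> (e m 0 / Dr m + \<pi> / S n m) + 2 * \<theta> ^ (m - n) * (1 + real (m - n))"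
  proof (intro add_mono mult_left_mono ratio)
    have "e m 0 / S n m * (Dr n / Dr m) = e m 0 / Dr m + e m 0 * (\<pi> / S n m)"
      unfolding split using pos by (simp add: field_simps)
    also have "e m 0 * (\<pi> / S n m) \<le> 1 * (\<pi> / S n m)"
      using e pos by (intro mult_right_mono) auto
    finally show "e m 0 / S n m * (Dr n / Dr m) \<le> e m 0 / Dr m + \<pi> / S n m" by simp
  qed (use \<theta>_bounds in auto)
  finally have "\<rho> n m - avoid {m} \<le> \<pi> / S n m + 2 * \<theta> ^ (m - n) * (1 + real (m - n))"
    using avoid_singleton[OF sm, of m] n by simp
  then have "avoid {n} * (\<rho> n m - avoid {m})
      \<le> avoid {n} * (\<pi> / S n m + 2 * \<theta> ^ (m - n) * (1 + real (m - n)))"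
    by (intro mult_left_mono) (simp_all add: avoid_def)
  moreover have "avoid {n, m} = \<rho> n m * avoid {n}"
    using avoid_insert2[OF sm _ n, of "{}"] by (simp add: insert_commute)
  ultimately show ?thesis by (simp add: \<pi>_def algebra_simps)
qed

text \<open>For fixed \<open>i\<close>, replacing \<open>c j\<close> by the larger
  \<open>c i\<close> leaves a factor \<open>1 / ln i\<close>. It cancels the sum of the terms
  \<open>\<pi> / S\<close>, which is at most \<open>2 * ln (Dr i)\<close>, so each row costs a
  constant times \<open>c i * avoid {i}\<close>.\<close>

lemma covariance_sum_le:
  assumes sm: "summable d" and n0: "n0 \<ge> 3" and \<delta>: "\<delta> \<ge> 1"
    and Dr: "\<And>n. n \<ge> n0 \<Longrightarrow> Dr n \<le> \<delta> * real n * ln (real n)" and N: "n0 \<le> N"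
  defines "c \<equiv> \<lambda>n. 1 / ln (real n)"
  shows "(\<Sum>i\<in>{n0..<N}. \<Sum>j\<in>{n0..<N}. c i * c j * (avoid {i, j} - avoid {i} * avoid {j}))
    \<le> (1 + 2 * (2 * (ln \<delta> + 2) + 2 / (1 - \<theta>)\<^sup>2)) * (\<Sum>i\<in>{n0..<N}. c i * avoid {i})"
proof -
  have ln_ge: "1 \<le> ln (real n)" if "n \<ge> n0" for n
  proof -
    have "exp 1 \<le> real n" using exp_le n0 that by simp
    then show ?thesis using n0 that by (subst ln_ge_iff) auto
  qed
  have c: "0 < c n" "c n \<le> 1" if "n \<ge> n0" for n
    using ln_ge[OF that] by (auto simp: c_def)
  have P: "0 \<le> avoid {n}" "avoid {n} \<le> 1" for n by (auto simp: avoid_def)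
  let ?cov = "\<lambda>i j. avoid {i, j} - avoid {i} * avoid {j}"
  have "(\<Sum>i\<in>{n0..<N}. \<Sum>j\<in>{n0..<N}. c i * c j * ?cov i j)
      = (\<Sum>i\<in>{n0..<N}. c i * c i * ?cov i i + 2 * (\<Sum>j\<in>{Suc i..<N}. c i * c j * ?cov i j))"
    by (rule sum_sum_symmetric[OF _ N]) (simp add: insert_commute mult.commute)
  also have "\<dots> \<le> (\<Sum>i\<in>{n0..<N}. (1 + 2 * (2 * (ln \<delta> + 2) + 2 / (1 - \<theta>)\<^sup>2)) * (c i * avoid {i}))"
  proof (intro sum_mono)
    have arith: "x + 2 * z \<le> (1 + 2 * k) * y" if "x \<le> y" "z \<le> y * k" for x y z k :: real
      using that by (simp add: algebra_simps)
    fix i assume i: "i \<in> {n0..<N}"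
    then have ci: "0 < c i" "c i \<le> 1" "1 \<le> ln (real i)" "1 \<le> real i" using c[of i] ln_ge[of i] n0 by auto
    have "c i * (c i * ?cov i i) \<le> c i * (1 * avoid {i})"
      using ci P[of i] by (intro mult_left_mono mult_mono) (auto simp: mult_left_le)
    then have diag: "c i * c i * ?cov i i \<le> c i * avoid {i}" by (simp only: mult.assoc mult_1)
    have "(\<Sum>j\<in>{Suc i..<N}. c i * c j * ?cov i j)
        \<le> (\<Sum>j\<in>{Suc i..<N}. c i * avoid {i} * (c i * (d (Suc j) / d (Suc i) / S i j)
            + 2 * \<theta> ^ (j - i) * (1 + real (j - i))))"
    proof (intro sum_mono)
      fix j assume j: "j \<in> {Suc i..<N}"
      define x where "x = d (Suc j) / d (Suc i) / S i j"
      define y where "y = 2 * \<theta> ^ (j - i) * (1 + real (j - i))"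
      have x: "0 \<le> x" using d_pos[of "Suc j"] d_pos[of "Suc i"] S_ge_1[of i j] j by (simp add: x_def)
      have y: "0 \<le> y" using \<theta>_bounds by (simp add: y_def)
      have cj: "0 < c j" "c j \<le> 1" using c[of j] i j by auto
      have "c j \<le> c i" unfolding c_def using ci i j n0 ln_ge[of j] by (intro divide_left_mono mult_pos_pos) auto
      have "c j * ?cov i j \<le> c j * (avoid {i} * (x + y))"
        using covariance_le[OF sm, of i j] i j n0 cj unfolding x_def y_def by (intro mult_left_mono) auto
      also have "\<dots> = avoid {i} * (c j * x + c j * y)" by (simp add: algebra_simps)
      also have "\<dots> \<le> avoid {i} * (c i * x + 1 * y)"
        using \<open>c j \<le> c i\<close> cj x y P[of i] by (intro mult_left_mono add_mono mult_right_mono) auto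
      finally have "c i * (c j * ?cov i j) \<le> c i * (avoid {i} * (c i * x + y))"
        using ci by (intro mult_left_mono) auto
      then show "c i * c j * ?cov i j \<le> c i * avoid {i} * (c i * x + y)" by (simp only: mult.assoc)
    qed
    also have "\<dots> = c i * avoid {i} * (c i * (\<Sum>j\<in>{Suc i..<N}. d (Suc j) / d (Suc i) / S i j)
            + (\<Sum>j\<in>{Suc i..<N}. 2 * \<theta> ^ (j - i) * (1 + real (j - i))))"
      by (simp only: sum_distrib_left[symmetric] sum.distrib)
    also have "\<dots> \<le> c i * avoid {i} * (2 * (ln \<delta> + 2) + 2 / (1 - \<theta>)\<^sup>2)"
    proof (intro mult_left_mono add_mono sum_geometric_le)
      \<comment> \<open>As \<open>ln i \<le> i\<close>, \<open>Dr i\<close> is at most quadratic in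
        \<open>i\<close>, and its logarithm is of order \<open>ln i\<close>.\<close>
      have "ln (Dr i) \<le> ln (\<delta> * real i * real i)"
      proof (intro ln_mono)
        have "Dr i \<le> \<delta> * real i * ln (real i)" using Dr i by simp
        also have "\<dots> \<le> \<delta> * real i * real i"
          using \<delta> ci ln_le_minus_one[of "real i"] by (intro mult_left_mono) auto
        finally show "Dr i \<le> \<delta> * real i * real i" .
        show "0 < Dr i" using Dr_ge_1[OF sm, of i] by linarith
      qed
      also have "\<dots> = ln \<delta> + 2 * ln (real i)" using \<delta> ci by (simp add: ln_mult)
      also have "\<dots> \<le> (ln \<delta> + 2) * ln (real i)"
        using mult_left_mono[OF ci(3), of "ln \<delta>"] \<delta> by (simp add: distrib_right)
      finally have *: "ln (Dr i) \<le> (ln \<delta> + 2) * ln (real i)" .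
      have "c i * (\<Sum>j\<in>{Suc i..<N}. d (Suc j) / d (Suc i) / S i j) \<le> c i * (2 * ln (Dr i))"
        using sum_increments_S_le[OF sm, of i N] i ci by (intro mult_left_mono) auto
      also have "\<dots> \<le> c i * (2 * ((ln \<delta> + 2) * ln (real i)))"
        using * ci by (intro mult_left_mono) auto
      also have "\<dots> = 2 * (ln \<delta> + 2)" using ci by (simp add: c_def)
      finally show "c i * (\<Sum>j\<in>{Suc i..<N}. d (Suc j) / d (Suc i) / S i j) \<le> 2 * (ln \<delta> + 2)" .
    qed (use ci P[of i] in auto)
    finally show "c i * c i * ?cov i i + 2 * (\<Sum>j\<in>{Suc i..<N}. c i * c j * ?cov i j)
        \<le> (1 + 2 * (2 * (ln \<delta> + 2) + 2 / (1 - \<theta>)\<^sup>2)) * (c i * avoid {i})"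
      by (rule arith[OF diag])
  qed
  finally show ?thesis by (simp only: sum_distrib_left)
qed

lemma infinitely_many_skipped:
  assumes sm: "summable d" and \<delta>: "\<delta> > 0"
    and Dr: "\<forall>\<^sub>F n in sequentially. Dr n \<le> \<delta> * real n * ln (real n)"
    and div: "\<not> summable (\<lambda>n. 1 / (Dr n * ln (real n)))"
  shows "\<P>(\<omega> in M. infinite (skipped_points X \<omega>)) = 1"
proof -
  obtain n1 where n1: "\<And>n. n \<ge> n1 \<Longrightarrow> Dr n \<le> \<delta> * real n * ln (real n)"
    using Dr unfolding eventually_sequentially by blast
  define n0 where "n0 = max n1 3"
  have n0: "n0 \<ge> 3" by (simp add: n0_def)
  define c where "c n = 1 / ln (real n)" for n :: nat
  define C where "C = 1 + 2 * (2 * (ln (max \<delta> 1) + 2) + 2 / (1 - \<theta>)\<^sup>2)"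
  define \<mu> where "\<mu> N = (\<Sum>i\<in>{n0..<N}. c i * avoid {i})" for N
  define Z where "Z N \<omega> = (\<Sum>i\<in>{n0..<N}. c i * indicator (ev {i} {}) \<omega>)" for N \<omega>
  have c: "0 < c n" "c n \<le> 1" if "n \<ge> n0" for n
  proof -
    have "exp 1 \<le> real n" using exp_le n0 that by simp
    then have "1 \<le> ln (real n)" using n0 that by (subst ln_ge_iff) auto
    then show "0 < c n" "c n \<le> 1" by (auto simp: c_def)
  qed
  \<comment> \<open>\<open>\<delta>\<close> is enlarged to at least 1 so that its logarithm is
    nonnegative.\<close>
  have bound: "Dr n \<le> max \<delta> 1 * real n * ln (real n)" if "n \<ge> n0" for n
  proof -
    have "Dr n \<le> \<delta> * (real n * ln (real n))" using n1[of n] that by (simp add: n0_def mult.assoc)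
    also have "\<dots> \<le> max \<delta> 1 * (real n * ln (real n))"
      using n0 that by (intro mult_right_mono) auto
    finally show ?thesis by (simp add: mult.assoc)
  qed
  have second: "\<P>(\<omega> in M. Z N \<omega> \<le> \<mu> N / 2) \<le> 4 * C / \<mu> N" if N: "n0 \<le> N" "\<mu> N > 0" for N
  proof -
    have inter: "ev {i} {} \<inter> ev {j} {} = ev {i, j} {}" for i j by (auto simp: ev_def)
    have "\<P>(\<omega> in M. Z N \<omega> \<le> \<mu> N / 2) \<le> 4 * (C * \<mu> N) / (\<mu> N)\<^sup>2"
      unfolding Z_def
      by (rule weighted_second_moment)
        (use covariance_sum_le[OF sm n0 _ bound N(1)] N in
          \<open>auto simp: \<mu>_def inter prob_ev_empty c_def C_def\<close>)
    then show ?thesis using N(2) by (simp add: power2_eq_square)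
  qed
  \<comment> \<open>By \<open>e_ge\<close>, \<open>avoid {i}\<close> is at least
    \<open>a 1 / 27 / Dr i\<close>, so bounded means would make the given series converge.\<close>
  have unbounded: "\<exists>N\<ge>n0. B \<le> \<mu> N" for B
  proof (rule ccontr)
    assume *: "\<not> ?thesis"
    have A: "a 1 / 27 > 0" using a_pos[of 1] by simp
    have "summable (\<lambda>i. a 1 / 27 * (1 / (Dr (i + n0) * ln (real (i + n0)))))"
    proof (rule bounded_imp_summable)
      fix n
      show "0 \<le> a 1 / 27 * (1 / (Dr (n + n0) * ln (real (n + n0))))"
        using A Dr_ge_1[OF sm, of "n + n0"] n0 by (intro mult_nonneg_nonneg) auto
      have "(\<Sum>i\<le>n. a 1 / 27 * (1 / (Dr (i + n0) * ln (real (i + n0)))))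
          \<le> (\<Sum>i\<le>n. c (i + n0) * avoid {i + n0})"
      proof (intro sum_mono)
        fix i
        have "a 1 / 27 / Dr (i + n0) \<le> e (i + n0) 0 / Dr (i + n0)"
          using n0 Dr_ge_1[OF sm, of "i + n0"] by (intro divide_right_mono e_ge) auto
        then have "a 1 / 27 / Dr (i + n0) \<le> avoid {i + n0}"
          using avoid_singleton[OF sm, of "i + n0"] n0 by simp
        then have "c (i + n0) * (a 1 / 27 / Dr (i + n0)) \<le> c (i + n0) * avoid {i + n0}"
          using c[of "i + n0"] by (intro mult_left_mono) auto
        then show "a 1 / 27 * (1 / (Dr (i + n0) * ln (real (i + n0)))) \<le> c (i + n0) * avoid {i + n0}"
          by (simp add: c_def mult_ac)
      qed
      also have "\<dots> = \<mu> (Suc n + n0)"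
        unfolding \<mu>_def using sum.shift_bounds_nat_ivl[of "\<lambda>i. c i * avoid {i}" 0 n0 "Suc n"]
        by (simp add: atLeast0LessThan lessThan_Suc_atMost)
      also have "\<dots> \<le> B" using * by (meson le_add2 linear)
      finally show "(\<Sum>i\<le>n. a 1 / 27 * (1 / (Dr (i + n0) * ln (real (i + n0))))) \<le> B" .
    qed
    then have "summable (\<lambda>i. 1 / (Dr (i + n0) * ln (real (i + n0))))"
      using A by (subst (asm) summable_cmult_iff) auto
    then show False using div summable_iff_shift[of "\<lambda>n. 1 / (Dr n * ln (real n))" n0] by simp
  qed
  have C: "C > 0"
    unfolding C_def using \<theta>_bounds ln_ge_zero[of "max \<delta> 1"] by (intro add_pos_nonneg) auto
  have Z[measurable]: "Z N \<in> borel_measurable M" for N unfolding Z_def[abs_def] by measurable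
  have null: "\<P>(\<omega> in M. \<forall>N. Z N \<omega> \<le> real b) = 0" for b :: nat
  proof (rule ccontr)
    let ?P = "\<P>(\<omega> in M. \<forall>N. Z N \<omega> \<le> real b)"
    assume "?P \<noteq> 0"
    then have P: "0 < ?P" using measure_nonneg[of M] by (simp add: less_le)
    \<comment> \<open>The first bound puts \<open>b\<close> below half the mean; the second makes
      the Chebyshev bound \<open>4 * C / \<mu> N\<close> at most half of \<open>?P\<close>.\<close>
    obtain N where N: "n0 \<le> N" "max (2 * real b + 1) (8 * C / ?P) \<le> \<mu> N" using unbounded by blast
    then have \<mu>: "0 < \<mu> N" by simp
    have "real b \<le> \<mu> N / 2" using N by simp
    then have "Z N \<omega> \<le> \<mu> N / 2" if "\<forall>N. Z N \<omega> \<le> real b" for \<omega>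
      using that order_trans by blast
    then have "?P \<le> \<P>(\<omega> in M. Z N \<omega> \<le> \<mu> N / 2)"
      by (intro finite_measure_mono) auto
    also have "\<dots> \<le> 4 * C / \<mu> N" using second N(1) \<mu> by blast
    finally have "?P * \<mu> N \<le> 4 * C" using \<mu> by (simp add: pos_le_divide_eq)
    moreover have "8 * C \<le> ?P * \<mu> N" using N P by (simp add: pos_divide_le_eq mult.commute)
    ultimately show False using C by linarith
  qed
  have "AE \<omega> in M. \<not> (\<forall>N. Z N \<omega> \<le> real b)" for b :: nat
    using null[of b] by (subst (asm) prob_eq_0) auto
  then have "AE \<omega> in M. \<forall>b::nat. \<not> (\<forall>N. Z N \<omega> \<le> real b)" unfolding AE_all_countable by blast
  then have "AE \<omega> in M. infinite (skipped_points X \<omega>)"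
  proof eventually_elim
    case (elim \<omega>)
    show ?case
    proof
      assume fin: "finite (skipped_points X \<omega>)"
      \<comment> \<open>The weights are at most 1, so \<open>Z\<close> is bounded by the number of
        skipped points.\<close>
      have "Z N \<omega> \<le> real (card (skipped_points X \<omega>))" for N
      proof -
        have "Z N \<omega> \<le> (\<Sum>i\<in>{n0..<N}. if i \<in> skipped_points X \<omega> then 1 else 0)"
          unfolding Z_def by (intro sum_mono) (use c in \<open>auto simp: ev_def indicator_def\<close>)
        also have "\<dots> = real (card ({n0..<N} \<inter> skipped_points X \<omega>))"
          by (simp add: sum.inter_restrict[symmetric])
        also have "\<dots> \<le> real (card (skipped_points X \<omega>))"
          using fin by (intro of_nat_mono card_mono) auto
        finally show ?thesis .
      qed
      then show False using elim by blast
    qed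
  qed
  then show ?thesis
    unfolding infinite_nat_iff_unbounded by (subst prob_Collect_eq_1) auto
qed

end

section \<open>Transfer to \<open>D\<close> with values in the extended nonnegative reals\<close>

theorem theorem1:
  fixes M :: "'w measure" and X :: "nat \<Rightarrow> 'w \<Rightarrow> nat"
    and p q r a \<xi> U :: "nat \<Rightarrow> real" and D :: "nat \<Rightarrow> ennreal"
  assumes "markov_chain M X 0 (walk_transition p q)"
    and "\<And>n. n \<ge> 1 \<Longrightarrow> q n = 1 - p n"
    and "\<And>n. n \<ge> 1 \<Longrightarrow> p n = 1/3 + r n"
    and "\<And>n. n \<ge> 1 \<Longrightarrow> 0 \<le> r n \<and> r n < 2/3"
    and "\<And>n. n \<ge> 1 \<Longrightarrow> r (n + 1) \<le> r n"
    and "r \<longlonglongrightarrow> 0"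
    and "O_lim (\<lambda>n. r n - r (n + 1)) (\<lambda>n. (r n)^2)"
    and "\<And>n. n \<ge> 1 \<Longrightarrow> a n = q n / p n"
    and "positive_solution a \<xi>"
    and "\<And>i. i \<ge> 1 \<Longrightarrow> U i = 1 / \<xi> i"
    and "\<And>m. m \<ge> 1 \<Longrightarrow> D m = D_lim U m"
  shows "((\<Sum>n. 1 / (D (n + 2) * ennreal (ln (real (n + 2))))) < \<infinity> \<longrightarrow>
            (AE \<omega> in M. finite (skipped_points X \<omega>)))
       \<and> ((\<exists>\<delta>::real. \<delta> > 0 \<and>
              (\<forall>\<^sub>F n in sequentially. D n \<le> ennreal (\<delta> * real n * ln (real n))))
            \<and> (\<Sum>n. 1 / (D (n + 2) * ennreal (ln (real (n + 2))))) = \<infinity> \<longrightarrow>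
            \<P>(\<omega> in M. infinite (skipped_points X \<omega>)) \<ge> 11/27)"
proof -
  have \<xi>: "\<xi> n > 0" "\<xi> n = 1 / a n * (1 + 1 / \<xi> (n + 1))" if "n \<ge> 1" for n
    using assms(9) that unfolding positive_solution_def by blast+
  have U_pos: "0 < U n" if "n \<ge> 1" for n
    using \<xi>(1)[OF that] assms(10)[OF that] by simp
  have U_rec: "U n * (1 + U (n + 1)) = a n" if n: "n \<ge> 1" for n
  proof -
    have "a n \<noteq> 0" using \<xi>[OF n] by auto
    then have "a n * \<xi> n = 1 + U (n + 1)"
      using \<xi>(2)[OF n] assms(10)[of "n + 1"] by simp
    then have "U n * (1 + U (n + 1)) = 1 / \<xi> n * (a n * \<xi> n)" using assms(10)[OF n] by simp
    then show ?thesis using \<xi>(1)[OF n] by simp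
  qed
  interpret skipping_chain p q r a U M X
  proof
    fix n :: nat assume n: "1 \<le> n"
    show "q n = 1 - p n" "p n = 1/3 + r n" "0 \<le> r n \<and> r n < 2/3" "r (n + 1) \<le> r n"
      "a n = q n / p n" "0 < U n" "U n * (1 + U (n + 1)) = a n"
      using n by (rule assms U_pos U_rec)+
  qed (rule assms(1))
  define f where "f n = 1 / (Dr n * ln (real n))" for n
  have f: "1 / (D (n + 2) * ennreal (ln (real (n + 2)))) = ennreal (f (n + 2))" "0 \<le> f (n + 2)"
    if "summable d" for n
  proof -
    have pos: "1 \<le> Dr (n + 2)" "0 < ln (real (n + 2))" using Dr_ge_1[OF that] by auto
    have "D (n + 2) = ennreal (Dr (n + 2))"
      using assms(11)[of "n + 2"] D_lim_summable[OF that] by simp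
    then show "1 / (D (n + 2) * ennreal (ln (real (n + 2)))) = ennreal (f (n + 2))"
      using pos by (simp add: f_def divide_ennreal flip: ennreal_mult ennreal_1)
    show "0 \<le> f (n + 2)" using pos by (simp add: f_def)
  qed
  have summable_f: "summable f \<longleftrightarrow> (\<Sum>n. 1 / (D (n + 2) * ennreal (ln (real (n + 2))))) \<noteq> \<infinity>"
    if sm: "summable d"
  proof -
    have "summable f \<longleftrightarrow> summable (\<lambda>n. f (n + 2))" using summable_iff_shift[of f 2] by simp
    also have "\<dots> \<longleftrightarrow> (\<Sum>n. ennreal (f (n + 2))) \<noteq> \<infinity>"
    proof
      assume "summable (\<lambda>n. f (n + 2))"
      then show "(\<Sum>n. ennreal (f (n + 2))) \<noteq> \<infinity>"
        using suminf_ennreal2[OF f(2)[OF sm]] by simp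
    qed (use f(2)[OF sm] in \<open>auto intro: summable_suminf_not_top\<close>)
    finally show ?thesis by (simp only: f(1)[OF sm])
  qed
  show ?thesis
  proof (intro conjI impI)
    assume "(\<Sum>n. 1 / (D (n + 2) * ennreal (ln (real (n + 2))))) < \<infinity>"
    then have "(\<Sum>n. 1 / (D (n + 2) * ennreal (ln (real (n + 2))))) \<noteq> \<infinity>" by (rule less_imp_neq)
    \<comment> \<open>If \<open>d\<close> is not summable the walk is recurrent and finiteness holds
      outright; otherwise the series is that of \<open>Dr\<close>.\<close>
    then show "AE \<omega> in M. finite (skipped_points X \<omega>)"
      using finitely_many_skipped_transient[OF _ assms(6,7)] finitely_many_skipped_recurrent
        summable_f unfolding f_def[abs_def] by blast
  next
    assume *: "(\<exists>\<delta>::real. \<delta> > 0 \<and>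
        (\<forall>\<^sub>F n in sequentially. D n \<le> ennreal (\<delta> * real n * ln (real n))))
      \<and> (\<Sum>n. 1 / (D (n + 2) * ennreal (ln (real (n + 2))))) = \<infinity>"
    then obtain \<delta> where \<delta>: "\<delta> > 0"
      "\<forall>\<^sub>F n in sequentially. D n \<le> ennreal (\<delta> * real n * ln (real n))" by blast
    have ev: "\<forall>\<^sub>F n in sequentially. D_lim U n \<le> ennreal (\<delta> * real n * ln (real n))"
      using eventually_conj[OF \<delta>(2) eventually_ge_at_top[of 1]]
      by (rule eventually_mono) (use assms(11) in auto)
    \<comment> \<open>The finite bound on \<open>D\<close> rules out \<open>D = \<infinity>\<close>,
      its value for non-summable \<open>d\<close>.\<close>
    have sm: "summable d"
    proof (rule ccontr)
      assume "\<not> summable d"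
      with ev show False
        by (auto simp: D_lim_not_summable eventually_sequentially top_unique)
    qed
    have "\<forall>\<^sub>F n in sequentially. Dr n \<le> \<delta> * real n * ln (real n)"
      using ev
    proof eventually_elim
      case (elim n)
      then show ?case
        using Dr_ge_1[OF sm, of n] by (auto simp: D_lim_summable[OF sm] ennreal_le_iff2)
    qed
    moreover have "\<not> summable f" using summable_f[OF sm] * by simp
    ultimately show "\<P>(\<omega> in M. infinite (skipped_points X \<omega>)) \<ge> 11/27"
      using infinitely_many_skipped[OF sm \<delta>(1)] by (simp add: f_def[abs_def])
  qed
qed

end
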